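(* Let $N\ge 2$ be an integer, $p>1$, and $\ell_{N,p}=\frac{1}{p-1}\left(\frac{1}{p-1}+2-N\right)$. Let $\mathcal E$ be the set of all solutions $\omega$ of $$\Delta'\omega+\ell_{N,p}\,\omega=0\ \text{ in } S^{N-1}_+,\qquad \frac{\partial\omega}{\partial\nu}+|\omega|^{p-1}\omega=0\ \text{ on }\partial S^{N-1}_+,$$ and let $\mathcal E_+=\{\omega\in\mathcal E:\omega\ge 0\}$. Then: 1. If $p\ge\frac{N-1}{N-2}$, then $\mathcal E=\{0\}$. 2. If $1<p\le\frac{N}{N-1}$, then $\mathcal E_+=\{0\}$. 3. If $\frac{N}{N-1}<p<\frac{N-1}{N-2}$, then $\mathcal E=\{\omega_s,-\omega_s,0\}$, where $\omega_s$ is the unique positive element of $\mathcal E$, i.e. the unique positive solution of $\Delta'\omega+\ell_{N,p}\,\omega=0$ in $S^{N-1}_+$, $\frac{\partial\omega}{\partial\nu}+|\omega|^{p-1}\omega=0$ on $\partial S^{N-1}_+$.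
   Context: $S^{N-1}$ is the unit sphere of $\mathbb R^N$, $S^{N-1}_+=\{x\in S^{N-1}:x_N>0\}$ is the open upper hemisphere, $\Delta'$ is the Laplace–Beltrami operator on $S^{N-1}$, and $\nu$ is the outward unit normal vector to $\partial S^{N-1}_+$ tangent to $S^{N-1}$. Solutions are understood in the classical sense ($C^2$ in $S^{N-1}_+$ and $C^1$ up to the boundary). When $N=2$, $\frac{N-1}{N-2}$ is read as $+\infty$ (so item 1 is void and item 3 concerns $2<p<\infty$). *)

theory Defs
  imports "HOL-Analysis.Analysis"
begin

definition C1_on :: "(real^'n) set \<Rightarrow> (real^'n \<Rightarrow> real) \<Rightarrow> bool" where
  "C1_on S f \<longleftrightarrow> (\<exists>G. continuous_on S G \<and>
     (\<forall>x\<in>S. (f has_derivative (\<lambda>h. G x \<bullet> h)) (at x within S)))"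

definition C2_on :: "(real^'n) set \<Rightarrow> (real^'n \<Rightarrow> real) \<Rightarrow> bool" where
  "C2_on S f \<longleftrightarrow> (\<exists>G (H :: real^'n \<Rightarrow> real^'n^'n). continuous_on S H \<and>
     (\<forall>x\<in>S. (f has_derivative (\<lambda>h. G x \<bullet> h)) (at x within S) \<and>
            (G has_derivative (\<lambda>h. H x *v h)) (at x within S)))"

definition partial_deriv :: "'n \<Rightarrow> (real^'n \<Rightarrow> real) \<Rightarrow> real^'n \<Rightarrow> real" where
  "partial_deriv i f x = deriv (\<lambda>t. f (x + t *\<^sub>R axis i 1)) 0"

(* Functions and vector fields on the unit sphere are differentiated through their extension
   y |-> w (y / |y|), where sgn y = y / |y|, which is constant along rays.  The radial derivative
   of the extension vanishes, so at a point x of the sphere its Euclidean gradient is tangent to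
   the sphere and is the Riemannian gradient for the induced metric.  For a tangent field X, the
   trace of the derivative of the extension at x is the sum of (D_t X) . t over an orthonormal
   basis of tangent vectors t, which is the Riemannian divergence. *)

definition sphere_grad :: "(real^'n \<Rightarrow> real) \<Rightarrow> real^'n \<Rightarrow> real^'n" where
  "sphere_grad \<omega> x = (\<chi> i. partial_deriv i (\<lambda>y. \<omega> (sgn y)) x)"

definition sphere_div :: "(real^'n \<Rightarrow> real^'n) \<Rightarrow> real^'n \<Rightarrow> real" where
  "sphere_div X x = (\<Sum>i\<in>UNIV. partial_deriv i (\<lambda>y. X (sgn y) $ i) x)"

definition laplace_beltrami :: "(real^'n \<Rightarrow> real) \<Rightarrow> real^'n \<Rightarrow> real" where
  "laplace_beltrami \<omega> = sphere_div (sphere_grad \<omega>)"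

(* The index k plays the role of the last coordinate. *)

definition hemisphere :: "'n \<Rightarrow> (real^'n) set" where
  "hemisphere k = {x. norm x = 1 \<and> x $ k > 0}"

definition hemisphere_boundary :: "'n \<Rightarrow> (real^'n) set" where
  "hemisphere_boundary k = {x. norm x = 1 \<and> x $ k = 0}"

definition closed_hemisphere :: "'n \<Rightarrow> (real^'n) set" where
  "closed_hemisphere k = hemisphere k \<union> hemisphere_boundary k"

(* Where x $ k = 0, the vector axis k 1 is orthogonal to x, hence tangent to the sphere, and it
   points into the hemisphere; the outward unit normal is therefore - axis k 1 at every boundary
   point.  Only values on the closed hemisphere enter, since t <= 0. *)

definition normal_deriv :: "'n \<Rightarrow> (real^'n \<Rightarrow> real) \<Rightarrow> real^'n \<Rightarrow> real" where
  "normal_deriv k \<omega> x =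
     vector_derivative (\<lambda>t. \<omega> (sgn (x + t *\<^sub>R (- axis k 1)))) (at 0 within {..0})"

(* Being C^2 in the open hemisphere, or C^1 up to its boundary, is expressed by the same property
   of the ray-constant extension on the open half-space, or on the closed half-space without the
   origin.  On the latter the derivative at boundary points is taken within the half-space. *)

definition classical_on_hemisphere :: "'n \<Rightarrow> (real^'n \<Rightarrow> real) \<Rightarrow> bool" where
  "classical_on_hemisphere k \<omega> \<longleftrightarrow>
     C2_on {x. x $ k > 0} (\<lambda>y. \<omega> (sgn y)) \<and>
     C1_on ({x. x $ k \<ge> 0} - {0}) (\<lambda>y. \<omega> (sgn y))"

definition ell :: "nat \<Rightarrow> real \<Rightarrow> real" where
  "ell N p = 1 / (p - 1) * (1 / (p - 1) + 2 - real N)"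

definition upper_exponent :: "nat \<Rightarrow> ereal" where
  "upper_exponent N = (if N = 2 then \<infinity> else ereal ((real N - 1) / (real N - 2)))"

(* A function on the closed hemisphere is represented by the total function that agrees with it
   there and vanishes elsewhere, so that equality in the solution set is equality on the closed
   hemisphere. *)

definition solutions :: "'n \<Rightarrow> real \<Rightarrow> (real^'n \<Rightarrow> real) set" where
  "solutions k p = {\<omega>.
     (\<forall>x. x \<notin> closed_hemisphere k \<longrightarrow> \<omega> x = 0) \<and>
     classical_on_hemisphere k \<omega> \<and>
     (\<forall>x\<in>hemisphere k. laplace_beltrami \<omega> x + ell CARD('n) p * \<omega> x = 0) \<and>
     (\<forall>x\<in>hemisphere_boundary k.
        normal_deriv k \<omega> x + \<bar>\<omega> x\<bar> powr (p - 1) * \<omega> x = 0)}"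

definition nonneg_solutions :: "'n \<Rightarrow> real \<Rightarrow> (real^'n \<Rightarrow> real) set" where
  "nonneg_solutions k p = {\<omega> \<in> solutions k p. \<forall>x\<in>closed_hemisphere k. \<omega> x \<ge> 0}"

definition positive_solution :: "'n \<Rightarrow> real \<Rightarrow> (real^'n \<Rightarrow> real) \<Rightarrow> bool" where
  "positive_solution k p \<omega> \<longleftrightarrow>
     \<omega> \<in> solutions k p \<and> (\<forall>x\<in>closed_hemisphere k. \<omega> x > 0)"

end

theory Submission
  imports Defs "HOL-Real_Asymp.Real_Asymp"
begin

text \<open>
  Everything is done by maximum principles with explicit barriers \<open>g (e \<bullet> x)\<close>, for which
  the Laplace--Beltrami operator is \<open>(1 - t\<^sup>2) g'' - (N - 1) t g'\<close> with \<open>t = e \<bullet> x\<close>; no integration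
  over the sphere is needed.  Write \<open>\<ell>\<close> for the coefficient \<open>ell N p\<close>.

  If \<open>\<ell> \<le> 0\<close>, the maximum of \<open>\<omega> / (c + t - t\<^sup>2 / 4)\<close>, \<open>t = x\<^sub>N\<close>, cannot be positive: the denominator
  is a strict supersolution, and for large \<open>c\<close> the boundary condition excludes the equator.
  If \<open>\<ell> \<ge> N - 1\<close>, a nonnegative nonzero solution is positive up to the boundary, and then the maximum of
  \<open>(c + x\<^sub>N) / \<omega>\<close> contradicts, for small \<open>c\<close>, either the equation or the boundary condition.

  If \<open>0 < \<ell> < N - 1\<close>, then for every unit vector \<open>e\<close> some \<open>c + t - d t\<^sup>2\<close>, \<open>t = e \<bullet> x\<close>, is a positive strict
  supersolution on \<open>{e \<bullet> x \<ge> 0}\<close>.  For horizontal \<open>e\<close>, comparison with the difference of \<open>\<omega>\<close> and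
  its reflection in \<open>e\<close> shows that \<open>\<omega>\<close> depends on \<open>x\<^sub>N\<close> only.  For vertical \<open>e\<close>, comparison shows that
  \<open>\<omega>\<close> is a multiple \<open>c \<psi>(x\<^sub>N)\<close> of the hypergeometric solution regular at the pole, and that
  \<open>\<psi>(0) > 0\<close>; the boundary condition then determines \<open>c\<close> up to sign or gives \<open>c = 0\<close>.
\<close>

section \<open>Calculus on the hemisphere\<close>

text \<open>The map is the orthogonal projection along the ray, scaled by the inverse norm; at a
  unit vector it is the projection onto the tangent space.\<close>

lemma has_derivative_sgn:
  fixes y :: "'a::real_inner"
  assumes "y \<noteq> 0"
  shows "(sgn has_derivative (\<lambda>h. (h - (sgn y \<bullet> h) *\<^sub>R sgn y) /\<^sub>R norm y)) (at y)"
proof -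
  have "((\<lambda>y. inverse (norm y) *\<^sub>R y) has_derivative
      (\<lambda>h. inverse (norm y) *\<^sub>R h + (- (inverse (norm y) * (h \<bullet> sgn y) * inverse (norm y))) *\<^sub>R y)) (at y)"
    using assms by (auto intro!: derivative_eq_intros has_derivative_norm)
  moreover have "inverse (norm y) *\<^sub>R h + (- (inverse (norm y) * (h \<bullet> sgn y) * inverse (norm y))) *\<^sub>R y
      = (h - (sgn y \<bullet> h) *\<^sub>R sgn y) /\<^sub>R norm y" for h
    by (simp add: sgn_div_norm algebra_simps inner_commute)
  moreover have "(\<lambda>y::'a. inverse (norm y) *\<^sub>R y) = sgn"
    by (simp add: fun_eq_iff sgn_div_norm)
  ultimately show ?thesis by simp
qed

lemma partial_deriv_eq:
  assumes "(f has_derivative D) (at x)"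
  shows "partial_deriv i f x = D (axis i 1)"
proof -
  have "((\<lambda>t. x + t *\<^sub>R axis i 1) has_derivative (\<lambda>t. t *\<^sub>R axis i 1)) (at (0::real))"
    by (auto intro!: derivative_eq_intros)
  then have "((\<lambda>t. f (x + t *\<^sub>R axis i 1)) has_derivative (\<lambda>t. D (t *\<^sub>R axis i 1))) (at 0)"
    by (rule has_derivative_compose) (use assms in simp)
  moreover have "D (t *\<^sub>R axis i 1) = D (axis i 1) * t" for t
    using linear_scale[OF has_derivative_linear[OF assms]] by (simp add: mult.commute)
  ultimately have "((\<lambda>t. f (x + t *\<^sub>R axis i 1)) has_real_derivative D (axis i 1)) (at 0)"
    by (simp add: has_field_derivative_def)
  then show ?thesis
    unfolding partial_deriv_def by (rule DERIV_imp_deriv)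
qed

lemma open_upper_halfspace: "open {y::real^'n. 0 < y $ k}"
  by (simp add: open_Collect_less continuous_intros)

lemma C2_on_halfspaceE:
  assumes "C2_on {y. 0 < y $ k} f"
  obtains G H where "continuous_on {y. 0 < y $ k} H"
    and "\<And>y. 0 < y $ k \<Longrightarrow> (f has_derivative (\<lambda>h. G y \<bullet> h)) (at y)"
    and "\<And>y. 0 < y $ k \<Longrightarrow> (G has_derivative (\<lambda>h. H y *v h)) (at y)"
  using assms unfolding C2_on_def
  by (auto simp: at_within_open[OF _ open_upper_halfspace])

lemma C2_on_halfspaceI:
  assumes "continuous_on {y. 0 < y $ k} H"
    and "\<And>y. 0 < y $ k \<Longrightarrow> (f has_derivative (\<lambda>h. G y \<bullet> h)) (at y)"
    and "\<And>y. 0 < y $ k \<Longrightarrow> (G has_derivative (\<lambda>h. H y *v h)) (at y)"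
  shows "C2_on {y. 0 < y $ k} f"
  unfolding C2_on_def
  by (intro exI[of _ G] exI[of _ H] conjI ballI) (use assms in \<open>simp_all add: at_within_open[OF _ open_upper_halfspace]\<close>)

lemma vec_nth_sgn: "sgn y $ i = y $ i / norm (y::real^'n)"
  by (simp add: sgn_div_norm divide_inverse)

lemma sgn_in_closed_hemisphere: "y \<in> {y. 0 \<le> y $ k} - {0} \<Longrightarrow> sgn y \<in> closed_hemisphere k"
  by (auto simp: closed_hemisphere_def hemisphere_def hemisphere_boundary_def norm_sgn vec_nth_sgn)

lemma closed_hemisphere_iff: "x \<in> closed_hemisphere k \<longleftrightarrow> norm x = 1 \<and> 0 \<le> x $ k"
  by (auto simp: closed_hemisphere_def hemisphere_def hemisphere_boundary_def)

lemma sgn_eq_self: "norm (x::'a::real_normed_vector) = 1 \<Longrightarrow> sgn x = x"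
  by (simp add: sgn_div_norm)

text \<open>The extension is constant along rays, so nothing changes to first order in the direction
  \<open>y\<close> itself.\<close>

lemma radial_derivative_zero:
  fixes \<omega> :: "'a::real_inner \<Rightarrow> real"
  assumes "((\<lambda>y. \<omega> (sgn y)) has_derivative (\<lambda>h. g \<bullet> h)) (at y)"
  shows "g \<bullet> y = 0"
proof -
  have "((\<lambda>t. y + t *\<^sub>R y) has_derivative (\<lambda>t. t *\<^sub>R y)) (at (0::real))"
    by (auto intro!: derivative_eq_intros)
  then have 1: "((\<lambda>t. \<omega> (sgn (y + t *\<^sub>R y))) has_derivative (\<lambda>t. g \<bullet> (t *\<^sub>R y))) (at 0)"
    by (rule has_derivative_compose) (use assms in simp)
  have 2: "((\<lambda>t. \<omega> (sgn (y + t *\<^sub>R y))) has_derivative (\<lambda>t. 0)) (at 0)"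
  proof (rule has_derivative_transform_within_open)
    show "((\<lambda>t. \<omega> (sgn y)) has_derivative (\<lambda>t. 0)) (at (0::real))" by simp
    show "open {-1<..<1::real}" by simp
    fix t :: real assume "t \<in> {-1<..<1}"
    then have "sgn ((1 + t) *\<^sub>R y) = sgn y" by (simp add: sgn_scaleR)
    then show "\<omega> (sgn y) = \<omega> (sgn (y + t *\<^sub>R y))" by (simp add: algebra_simps)
  qed simp
  show ?thesis
    using fun_cong[OF has_derivative_unique[OF 1 2], of 1] by simp
qed

text \<open>At a unit vector the derivative of \<open>sgn\<close> is the tangential projection, so
  the divergence is \<open>trace H\<close> minus the radial entry
  \<open>x \<bullet> (H *v x)\<close>, which vanishes. All later computations of the operator go
  through this Euclidean trace.\<close>

lemma laplace_beltrami_eq_trace: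
  fixes \<omega> :: "real^'n \<Rightarrow> real"
  assumes x: "x \<in> hemisphere k"
    and G: "\<And>y. 0 < y $ k \<Longrightarrow> ((\<lambda>y. \<omega> (sgn y)) has_derivative (\<lambda>h. G y \<bullet> h)) (at y)"
    and H: "(G has_derivative (\<lambda>h. H *v h)) (at x)"
  shows "laplace_beltrami \<omega> x = trace H"
proof -
  have nx: "norm x = 1" and xk: "0 < x $ k" using x by (auto simp: hemisphere_def)
  have sx: "sgn x = x" and x0: "x \<noteq> 0" using nx by (auto simp: sgn_eq_self)
  have grad: "sphere_grad \<omega> y = G y" if "0 < y $ k" for y
    by (simp add: sphere_grad_def vec_eq_iff partial_deriv_eq[OF G[OF that]] inner_axis)
  have "((\<lambda>y. G (sgn y)) has_derivative (\<lambda>h. H *v (h - (x \<bullet> h) *\<^sub>R x))) (at x)"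
    using has_derivative_compose[OF has_derivative_sgn[OF x0], of G] H by (simp add: sx nx)
  then have dG: "((\<lambda>y. sphere_grad \<omega> (sgn y)) has_derivative (\<lambda>h. H *v (h - (x \<bullet> h) *\<^sub>R x))) (at x)"
  proof (rule has_derivative_transform_within_open[OF _ open_upper_halfspace[of k]])
    fix y :: "real^'n" assume "y \<in> {y. 0 < y $ k}"
    then have "0 < sgn y $ k" by (auto simp: vec_nth_sgn intro!: divide_pos_pos)
    then show "G (sgn y) = sphere_grad \<omega> (sgn y)" using grad by simp
  qed (use xk in simp)
  have "partial_deriv i (\<lambda>y. sphere_grad \<omega> (sgn y) $ i) x = (H *v (axis i 1 - (x $ i) *\<^sub>R x)) $ i" for i
    using partial_deriv_eq[OF bounded_linear.has_derivative[OF bounded_linear_vec_nth dG], of i i]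
    by (simp add: inner_axis)
  then have "laplace_beltrami \<omega> x = (\<Sum>i\<in>UNIV. (H *v (axis i 1 - (x $ i) *\<^sub>R x)) $ i)"
    by (simp add: laplace_beltrami_def sphere_div_def)
  also have "\<dots> = (\<Sum>i\<in>UNIV. H $ i $ i - x $ i * (H *v x) $ i)"
    by (intro sum.cong refl)
       (simp add: matrix_vector_mult_diff_distrib matrix_vector_mult_scaleR matrix_vector_mult_basis column_def)
  also have "\<dots> = trace H - x \<bullet> (H *v x)"
    by (simp add: sum_subtractf trace_def inner_vec_def)
  \<comment> \<open>Differentiate \<open>G y \<bullet> y = 0\<close> in the direction
    \<open>x\<close>; the extra term \<open>G x \<bullet> x\<close> is zero by the same
    identity.\<close>
  also have "x \<bullet> (H *v x) = 0"
  proof -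
    have 1: "((\<lambda>y. G y \<bullet> y) has_derivative (\<lambda>h. G x \<bullet> h + (H *v h) \<bullet> x)) (at x)"
      using H by (auto intro!: derivative_eq_intros)
    have 2: "((\<lambda>y. G y \<bullet> y) has_derivative (\<lambda>h. 0)) (at x)"
    proof (rule has_derivative_transform_within_open[OF _ open_upper_halfspace[of k]])
      show "((\<lambda>y. 0) has_derivative (\<lambda>h. 0)) (at x)" by simp
    qed (use xk radial_derivative_zero[OF G] in auto)
    have "G x \<bullet> x + (H *v x) \<bullet> x = 0"
      using fun_cong[OF has_derivative_unique[OF 1 2], of x] by simp
    then show ?thesis using radial_derivative_zero[OF G[OF xk]] by (simp add: inner_commute)
  qed
  finally show ?thesis by simp
qed

lemma C1_on_lincomb:
  assumes "C1_on S f" "C1_on S g"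
  shows "C1_on S (\<lambda>x. a * f x + b * g x)"
proof -
  obtain G1 G2 where "continuous_on S G1" "\<forall>x\<in>S. (f has_derivative (\<lambda>h. G1 x \<bullet> h)) (at x within S)"
    "continuous_on S G2" "\<forall>x\<in>S. (g has_derivative (\<lambda>h. G2 x \<bullet> h)) (at x within S)"
    using assms unfolding C1_on_def by blast
  then show ?thesis
    unfolding C1_on_def
    by (intro exI[of _ "\<lambda>x. a *\<^sub>R G1 x + b *\<^sub>R G2 x"])
       (auto intro!: continuous_intros derivative_eq_intros simp: inner_add_left)
qed

lemma classical_lincomb:
  assumes "classical_on_hemisphere k f" "classical_on_hemisphere k g"
  shows "classical_on_hemisphere k (\<lambda>x. a * f x + b * g x)"
    and "x \<in> hemisphere k \<Longrightarrow> laplace_beltrami (\<lambda>x. a * f x + b * g x) x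
           = a * laplace_beltrami f x + b * laplace_beltrami g x"
proof -
  from assms have c2: "C2_on {y. 0 < y $ k} (\<lambda>y. f (sgn y))" "C2_on {y. 0 < y $ k} (\<lambda>y. g (sgn y))"
    and c1: "C1_on ({x. x $ k \<ge> 0} - {0}) (\<lambda>y. f (sgn y))" "C1_on ({x. x $ k \<ge> 0} - {0}) (\<lambda>y. g (sgn y))"
    by (auto simp: classical_on_hemisphere_def)
  obtain G1 H1 where c1': "continuous_on {y. 0 < y $ k} H1"
    and G1: "\<And>y. 0 < y $ k \<Longrightarrow> ((\<lambda>y. f (sgn y)) has_derivative (\<lambda>h. G1 y \<bullet> h)) (at y)"
    and H1: "\<And>y. 0 < y $ k \<Longrightarrow> (G1 has_derivative (\<lambda>h. H1 y *v h)) (at y)"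
    using C2_on_halfspaceE[OF c2(1)] by metis
  obtain G2 H2 where c2': "continuous_on {y. 0 < y $ k} H2"
    and G2: "\<And>y. 0 < y $ k \<Longrightarrow> ((\<lambda>y. g (sgn y)) has_derivative (\<lambda>h. G2 y \<bullet> h)) (at y)"
    and H2: "\<And>y. 0 < y $ k \<Longrightarrow> (G2 has_derivative (\<lambda>h. H2 y *v h)) (at y)"
    using C2_on_halfspaceE[OF c2(2)] by metis
  let ?G = "\<lambda>y. a *\<^sub>R G1 y + b *\<^sub>R G2 y" and ?H = "\<lambda>y. a *\<^sub>R H1 y + b *\<^sub>R H2 y"
  have G: "((\<lambda>y. a * f (sgn y) + b * g (sgn y)) has_derivative (\<lambda>h. ?G y \<bullet> h)) (at y)" if "0 < y $ k" for y
    using G1[OF that] G2[OF that] by (auto intro!: derivative_eq_intros simp: inner_add_left)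
  have H: "(?G has_derivative (\<lambda>h. ?H y *v h)) (at y)" if "0 < y $ k" for y
    using H1[OF that] H2[OF that]
    by (auto intro!: derivative_eq_intros simp: matrix_vector_mult_add_rdistrib scaleR_matrix_vector_assoc)
  have "C2_on {y. 0 < y $ k} (\<lambda>y. a * f (sgn y) + b * g (sgn y))"
    by (rule C2_on_halfspaceI[OF _ G H]) (intro continuous_intros c1' c2')
  then show "classical_on_hemisphere k (\<lambda>x. a * f x + b * g x)"
    using C1_on_lincomb[OF c1] by (simp add: classical_on_hemisphere_def)
  assume x: "x \<in> hemisphere k"
  then have "0 < x $ k" by (simp add: hemisphere_def)
  then show "laplace_beltrami (\<lambda>x. a * f x + b * g x) x = a * laplace_beltrami f x + b * laplace_beltrami g x"
    using laplace_beltrami_eq_trace[OF x G H] laplace_beltrami_eq_trace[OF x G1 H1]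
      laplace_beltrami_eq_trace[OF x G2 H2]
    by (simp add: trace_def sum.distrib sum_distrib_left)
qed

section \<open>First- and second-order conditions at a maximum\<close>

lemma second_derivative_nonpos_at_local_max:
  fixes f f' :: "real \<Rightarrow> real"
  assumes "0 < d" and f: "\<And>t. \<bar>t\<bar> < d \<Longrightarrow> (f has_real_derivative f' t) (at t)"
    and f': "(f' has_real_derivative l) (at 0)"
    and max: "\<And>t. \<bar>t\<bar> < d \<Longrightarrow> f t \<le> f 0"
  shows "l \<le> 0"
proof (rule ccontr)
  assume "\<not> l \<le> 0"
  then have "0 < l" by simp
  have "f' 0 = 0"
    using DERIV_local_max[OF f[of 0], of d] \<open>0 < d\<close> max by auto
  obtain e where e: "0 < e" "\<And>h. 0 < h \<Longrightarrow> h < e \<Longrightarrow> f' 0 < f' (0 + h)"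
    using DERIV_pos_inc_right[OF f' \<open>0 < l\<close>] by blast
  define t where "t = min d e / 2"
  have t: "0 < t" "t < d" "t < e" using \<open>0 < d\<close> e by (auto simp: t_def)
  have "f 0 < f t"
  proof (rule DERIV_pos_imp_increasing_open[of 0 t])
    show "continuous_on {0..t} f"
      using t f by (intro continuous_at_imp_continuous_on) (force intro: DERIV_isCont)
    fix s assume "0 < s" "s < t"
    then show "\<exists>y. (f has_real_derivative y) (at s) \<and> 0 < y"
      using t f[of s] e(2)[of s] \<open>f' 0 = 0\<close> by (intro exI[of _ "f' s"]) simp
  qed (use t in simp)
  then show False using max[of t] t by simp
qed

text \<open>A maximum on the sphere is also one of the ray-constant extension in space, so each
  diagonal Hessian entry is nonpositive along its coordinate line. The neighbourhood
  \<open>U\<close> admits maxima over a part of the hemisphere.\<close>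

lemma laplace_beltrami_nonpos_at_local_max:
  fixes f :: "real^'n \<Rightarrow> real"
  assumes f: "classical_on_hemisphere k f" and x: "x \<in> hemisphere k"
    and "open U" "x \<in> U" and max: "\<And>y. y \<in> U \<Longrightarrow> y \<in> hemisphere k \<Longrightarrow> f y \<le> f x"
  shows "laplace_beltrami f x \<le> 0"
proof -
  obtain G H where G: "\<And>y. 0 < y $ k \<Longrightarrow> ((\<lambda>y. f (sgn y)) has_derivative (\<lambda>h. G y \<bullet> h)) (at y)"
    and H: "\<And>y. 0 < y $ k \<Longrightarrow> (G has_derivative (\<lambda>h. H y *v h)) (at y)"
    using f C2_on_halfspaceE unfolding classical_on_hemisphere_def by metis
  have nx: "norm x = 1" and xk: "0 < x $ k" using x by (auto simp: hemisphere_def)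
  have sx: "sgn x = x" and x0: "x \<noteq> 0" using nx by (auto simp: sgn_eq_self)
  have "eventually (\<lambda>y. sgn y \<in> U) (nhds x)"
    using has_derivative_continuous[OF has_derivative_sgn[OF x0]] \<open>open U\<close> \<open>x \<in> U\<close>
    unfolding continuous_within sx eventually_nhds_conv_at by (auto dest: topological_tendstoD simp: sx)
  moreover have "eventually (\<lambda>y. 0 < y $ k) (nhds x)"
    using eventually_nhds_in_open[OF open_upper_halfspace, of x k] xk by simp
  ultimately have "eventually (\<lambda>y. sgn y \<in> U \<and> 0 < y $ k) (nhds x)"
    by (rule eventually_conj)
  then obtain d where d: "0 < d" "\<And>y. dist y x < d \<Longrightarrow> sgn y \<in> U \<and> 0 < y $ k"
    unfolding eventually_nhds_metric by blast
  have "H x $ i $ i \<le> 0" for i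
  proof (rule second_derivative_nonpos_at_local_max[OF d(1)])
    let ?c = "\<lambda>t. x + t *\<^sub>R axis i (1::real)"
    have c: "(?c has_derivative (\<lambda>t. t *\<^sub>R axis i 1)) (at t)" for t
      by (auto intro!: derivative_eq_intros)
    have near: "sgn (?c t) \<in> U" "0 < ?c t $ k" if "\<bar>t\<bar> < d" for t
      using d(2)[of "?c t"] that by (auto simp: dist_norm)
    show "((\<lambda>t. f (sgn (?c t))) has_real_derivative G (?c t) $ i) (at t)" if "\<bar>t\<bar> < d" for t
      by (rule has_derivative_imp_has_field_derivative[OF has_derivative_compose[OF c G[OF near(2)[OF that]]]])
        (simp add: inner_axis)
    have "((\<lambda>t. G (?c t)) has_derivative (\<lambda>t. H x *v (t *\<^sub>R axis i 1))) (at 0)"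
      using has_derivative_compose[OF c, of G _ 0] H[OF xk] by simp
    from bounded_linear.has_derivative[OF bounded_linear_vec_nth this, of i]
    show "((\<lambda>t. G (?c t) $ i) has_real_derivative H x $ i $ i) (at 0)"
      by (rule has_derivative_imp_has_field_derivative)
        (simp add: matrix_vector_mult_scaleR matrix_vector_mult_basis column_def)
    fix t :: real assume t: "\<bar>t\<bar> < d"
    have "?c t \<noteq> 0" using near(2)[OF t] by (metis less_irrefl zero_index)
    then have "sgn (?c t) \<in> hemisphere k"
      using near(2)[OF t] by (auto simp: hemisphere_def vec_nth_sgn norm_sgn)
    then show "f (sgn (?c t)) \<le> f (sgn (?c 0))"
      using max near(1)[OF t] by (simp add: sx)
  qed
  then show ?thesis
    using laplace_beltrami_eq_trace[OF x G H] xk by (simp add: trace_def sum_nonpos)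
qed

lemma normal_deriv_eqI:
  assumes "((\<lambda>t. f (sgn (x + t *\<^sub>R (- axis k 1)))) has_real_derivative D) (at 0 within {..0})"
  shows "normal_deriv k f x = D"
proof -
  have "at (0::real) within {..0} \<noteq> bot"
    proof -
    have "{..<0::real} \<subseteq> {..0}" by auto
    then show ?thesis
      using trivial_limit_at_left_real[of 0] at_le by (metis bot_unique)
  qed
  then show ?thesis
    unfolding normal_deriv_def
    using assms by (intro vector_derivative_within) (auto simp: has_real_derivative_iff_has_vector_derivative)
qed

lemma boundary_ray:
  assumes "x \<in> hemisphere_boundary k" and "t \<le> 0"
  shows "x + t *\<^sub>R (- axis k 1) \<in> {x. x $ k \<ge> 0} - {0}"
proof -
  have nx: "norm x = 1" and xk: "x $ k = 0" using assms by (auto simp: hemisphere_boundary_def)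
  \<comment> \<open>Moving along the axis keeps the component along \<open>x\<close> equal to 1, so
    the ray misses the origin.\<close>
  then have "(x + t *\<^sub>R (- axis k 1)) \<bullet> x = 1"
    by (simp add: inner_diff_left inner_axis' norm_eq_1)
  then have "x + t *\<^sub>R (- axis k 1) \<noteq> 0" by auto
  then show ?thesis using assms(2) xk by simp
qed

text \<open>Regularity up to the boundary makes the \<open>vector_derivative\<close> in
  \<open>normal_deriv\<close> a genuine one-sided derivative: the ray \<open>t \<le> 0\<close> stays
  in the closed half-space, where the extension is differentiable.\<close>

lemma has_normal_deriv:
  assumes f: "classical_on_hemisphere k f" and x: "x \<in> hemisphere_boundary k"
  shows "((\<lambda>t. f (sgn (x + t *\<^sub>R (- axis k 1)))) has_real_derivative normal_deriv k f x) (at 0 within {..0})"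
proof -
  let ?S = "{x. x $ k \<ge> 0} - {0}" and ?c = "\<lambda>t. x + t *\<^sub>R (- axis k (1::real))"
  have nx: "norm x = 1" and xk: "x $ k = 0" using x by (auto simp: hemisphere_boundary_def)
  have "x \<in> ?S" using nx xk by auto
  then obtain g where g: "((\<lambda>y. f (sgn y)) has_derivative (\<lambda>h. g \<bullet> h)) (at x within ?S)"
    using f unfolding classical_on_hemisphere_def C1_on_def by blast
  have c: "?c t \<in> ?S" if "t \<le> 0" for t
    by (rule boundary_ray[OF x that])
  have "(?c has_derivative (\<lambda>t. t *\<^sub>R (- axis k 1))) (at 0 within {..0})"
    by (auto intro!: derivative_eq_intros)
  then have "((\<lambda>t. f (sgn (?c t))) has_derivative (\<lambda>t. g \<bullet> (t *\<^sub>R (- axis k 1)))) (at 0 within {..0})"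
    by (rule has_derivative_in_compose) (use g c in \<open>auto intro: has_derivative_subset\<close>)
  then have D: "((\<lambda>t. f (sgn (?c t))) has_real_derivative (- (g $ k))) (at 0 within {..0})"
    by (rule has_derivative_imp_has_field_derivative) (simp add: inner_axis)
  then show ?thesis using normal_deriv_eqI[OF D] by simp
qed

lemma normal_deriv_lincomb:
  assumes "classical_on_hemisphere k f" "classical_on_hemisphere k g" and "x \<in> hemisphere_boundary k"
  shows "normal_deriv k (\<lambda>x. a * f x + b * g x) x = a * normal_deriv k f x + b * normal_deriv k g x"
  by (intro normal_deriv_eqI DERIV_add DERIV_cmult has_normal_deriv assms)

text \<open>The parameter increases in the outward direction, so a negative derivative would give
  larger values at points just inside.\<close>

lemma normal_deriv_nonneg_at_local_max:
  fixes f :: "real^'n \<Rightarrow> real"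
  assumes f: "classical_on_hemisphere k f" and x: "x \<in> hemisphere_boundary k"
    and "open U" "x \<in> U" and max: "\<And>y. y \<in> U \<Longrightarrow> y \<in> closed_hemisphere k \<Longrightarrow> f y \<le> f x"
  shows "0 \<le> normal_deriv k f x"
proof (rule ccontr)
  let ?c = "\<lambda>t. x + t *\<^sub>R (- axis k (1::real))"
  assume "\<not> 0 \<le> normal_deriv k f x"
  then have neg: "normal_deriv k f x < 0" by simp
  have nx: "norm x = 1" and xk: "x $ k = 0" using x by (auto simp: hemisphere_boundary_def)
  have sx: "sgn x = x" and x0: "x \<noteq> 0" using nx by (auto simp: sgn_eq_self)
  have "((\<lambda>t. sgn (?c t)) \<longlongrightarrow> sgn (?c 0)) (at_left 0)"
    using x0 by (intro tendsto_intros tendsto_sgn) auto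
  then have "eventually (\<lambda>t. sgn (?c t) \<in> U) (at_left 0)"
    using \<open>open U\<close> \<open>x \<in> U\<close> by (intro topological_tendstoD) (auto simp: sx)
  then obtain b where b: "b < 0" "\<And>t. b < t \<Longrightarrow> t < 0 \<Longrightarrow> sgn (?c t) \<in> U"
    unfolding eventually_at_left_field by blast
  obtain d where d: "0 < d" "\<And>h. 0 < h \<Longrightarrow> 0 - h \<in> {..0} \<Longrightarrow> h < d \<Longrightarrow> f (sgn (?c 0)) < f (sgn (?c (0 - h)))"
    using has_real_derivative_neg_dec_left[OF has_normal_deriv[OF f x] neg] by blast
  define h where "h = min d (- b) / 2"
  have h: "0 < h" "h < d" "b < - h" using b d by (auto simp: h_def)
  have "sgn (?c (- h)) \<in> closed_hemisphere k"
    using h by (intro sgn_in_closed_hemisphere boundary_ray[OF x]) simp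
  then have "f (sgn (?c (- h))) \<le> f x"
    using max b(2)[of "- h"] h by simp
  then show False using d(2)[of h] h by (simp add: sx)
qed

section \<open>Functions of one linear coordinate\<close>

lemma normal_deriv_eq_gradient:
  assumes "((\<lambda>y. f (sgn y)) has_derivative (\<lambda>h. g \<bullet> h)) (at x)"
  shows "normal_deriv k f x = - (g $ k)"
proof (rule normal_deriv_eqI)
  have "((\<lambda>t. x + t *\<^sub>R (- axis k (1::real))) has_derivative (\<lambda>t. t *\<^sub>R (- axis k 1))) (at 0 within {..0})"
    by (auto intro!: derivative_eq_intros)
  then have "((\<lambda>t. f (sgn (x + t *\<^sub>R (- axis k 1)))) has_derivative (\<lambda>t. g \<bullet> (t *\<^sub>R (- axis k 1)))) (at 0 within {..0})"
    by (rule has_derivative_compose) (use assms in simp)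
  then show "((\<lambda>t. f (sgn (x + t *\<^sub>R (- axis k 1)))) has_real_derivative - (g $ k)) (at 0 within {..0})"
    by (rule has_derivative_imp_has_field_derivative) (simp add: inner_axis)
qed

text \<open>Chain rule for \<open>g (e \<bullet> sgn y)\<close>. On the sphere the tangential part
  of \<open>e\<close> has squared length \<open>e \<bullet> e - (e \<bullet> x)\<^sup>2\<close> and
  is orthogonal to \<open>x\<close>; the tangential projection of trace \<open>N - 1\<close> gives
  the first-order term. The profile is smooth only on an open \<open>I\<close> around the values of
  \<open>e \<bullet> x\<close>, as suits a power series with bounded domain.\<close>

lemma
  fixes e :: "real^'n" and g g' g'' :: "real \<Rightarrow> real"
  assumes I: "open I" "\<And>x. x \<in> closed_hemisphere k \<Longrightarrow> e \<bullet> x \<in> I"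
    and g: "\<And>t. t \<in> I \<Longrightarrow> (g has_real_derivative g' t) (at t)"
    and g': "\<And>t. t \<in> I \<Longrightarrow> (g' has_real_derivative g'' t) (at t)"
    and g'': "continuous_on I g''"
  shows classical_ridge: "classical_on_hemisphere k (\<lambda>x. g (e \<bullet> x))"
    and laplace_beltrami_ridge: "x \<in> hemisphere k \<Longrightarrow> laplace_beltrami (\<lambda>x. g (e \<bullet> x)) x =
      (e \<bullet> e - (e \<bullet> x)\<^sup>2) * g'' (e \<bullet> x) - (real CARD('n) - 1) * (e \<bullet> x) * g' (e \<bullet> x)"
    and normal_deriv_ridge: "x \<in> hemisphere_boundary k \<Longrightarrow>
      normal_deriv k (\<lambda>x. g (e \<bullet> x)) x = - (g' (e \<bullet> x) * e $ k)"
proof -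
  let ?S = "{y::real^'n. 0 \<le> y $ k} - {0}"
  define \<tau> where "\<tau> y = e \<bullet> sgn y" for y
  define a where "a y = e - \<tau> y *\<^sub>R sgn y" for y
  define G where "G y = (g' (\<tau> y) / norm y) *\<^sub>R a y" for y
  \<comment> \<open>The Hessian of the extension: the mixed terms come from
    \<open>1 / norm y\<close> and from \<open>\<tau>\<close> inside \<open>a\<close>, the last one
    from \<open>sgn\<close> inside \<open>a\<close>.\<close>
  define H :: "real^'n \<Rightarrow> real^'n^'n" where "H y = (\<chi> i j. (g'' (\<tau> y) * (a y $ i * a y $ j)
      - g' (\<tau> y) * (sgn y $ j * a y $ i + a y $ j * sgn y $ i)
      - g' (\<tau> y) * \<tau> y * ((if i = j then 1 else 0) - sgn y $ i * sgn y $ j)) / (norm y)\<^sup>2)" for y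
  have \<tau>I: "\<tau> y \<in> I" if "y \<in> ?S" for y
    unfolding \<tau>_def by (rule I(2)[OF sgn_in_closed_hemisphere[OF that]])
  have \<tau>: "(\<tau> has_derivative (\<lambda>h. (a y \<bullet> h) / norm y)) (at y)" if "y \<noteq> 0" for y
    unfolding \<tau>_def a_def
    by (rule has_derivative_eq_rhs[OF has_derivative_inner_right[OF has_derivative_sgn[OF that]]])
       (auto simp: fun_eq_iff inner_diff_right inner_diff_left inner_commute divide_inverse algebra_simps)
  have dG1: "((\<lambda>y. g (e \<bullet> sgn y)) has_derivative (\<lambda>h. G y \<bullet> h)) (at y)" if "y \<in> ?S" for y
  proof -
    have "y \<noteq> 0" using that by simp
    from has_derivative_compose[OF \<tau>[OF this] g[OF \<tau>I[OF that], unfolded has_field_derivative_def]]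
    show ?thesis by (simp add: G_def \<tau>_def)
  qed
  have da: "(a has_derivative (\<lambda>h. - (((a y \<bullet> h) / norm y) *\<^sub>R sgn y + (\<tau> y / norm y) *\<^sub>R (h - (sgn y \<bullet> h) *\<^sub>R sgn y)))) (at y)"
    if "y \<noteq> 0" for y
    unfolding a_def[abs_def]
    apply (rule has_derivative_eq_rhs)
     apply (rule derivative_intros \<tau>[OF that] has_derivative_sgn[OF that])+
    apply (simp add: fun_eq_iff a_def divide_inverse algebra_simps)
    done
  have dG: "(G has_derivative (\<lambda>h. H y *v h)) (at y)" if "y \<in> ?S" for y
  proof -
    have y: "y \<noteq> 0" using that by simp
    have n: "((\<lambda>y. inverse (norm y)) has_derivative (\<lambda>h. - (inverse (norm y) * (h \<bullet> sgn y) * inverse (norm y)))) (at y)"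
      using y by (auto intro!: derivative_eq_intros has_derivative_norm)
    have g1: "((\<lambda>y. g' (\<tau> y)) has_derivative (\<lambda>h. g'' (\<tau> y) * ((a y \<bullet> h) / norm y))) (at y)"
      using has_derivative_compose[OF \<tau>[OF y] g'[OF \<tau>I[OF that], unfolded has_field_derivative_def]] .
    have "(G has_derivative (\<lambda>h. (g' (\<tau> y) * inverse (norm y)) *\<^sub>R
          (- (((a y \<bullet> h) / norm y) *\<^sub>R sgn y + (\<tau> y / norm y) *\<^sub>R (h - (sgn y \<bullet> h) *\<^sub>R sgn y)))
        + (g' (\<tau> y) * - (inverse (norm y) * (h \<bullet> sgn y) * inverse (norm y))
           + g'' (\<tau> y) * ((a y \<bullet> h) / norm y) * inverse (norm y)) *\<^sub>R a y)) (at y)"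
      unfolding G_def[abs_def] divide_inverse
      using has_derivative_scaleR[OF has_derivative_mult[OF g1 n] da[OF y]] by (simp add: divide_inverse)
    moreover have "(g' (\<tau> y) * inverse (norm y)) *\<^sub>R
          (- (((a y \<bullet> h) / norm y) *\<^sub>R sgn y + (\<tau> y / norm y) *\<^sub>R (h - (sgn y \<bullet> h) *\<^sub>R sgn y)))
        + (g' (\<tau> y) * - (inverse (norm y) * (h \<bullet> sgn y) * inverse (norm y))
           + g'' (\<tau> y) * ((a y \<bullet> h) / norm y) * inverse (norm y)) *\<^sub>R a y = H y *v h" for h
    proof -
      have "(H y *v h) $ i = (g'' (\<tau> y) * (a y $ i * (a y \<bullet> h))
            - g' (\<tau> y) * ((sgn y \<bullet> h) * a y $ i + (a y \<bullet> h) * sgn y $ i)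
            - g' (\<tau> y) * \<tau> y * (h $ i - sgn y $ i * (sgn y \<bullet> h))) / (norm y)\<^sup>2" for i
      proof -
        have "(H y *v h) $ i = (\<Sum>j\<in>UNIV. (g'' (\<tau> y) * (a y $ i * (a y $ j * h $ j))
            - g' (\<tau> y) * ((sgn y $ j * h $ j) * a y $ i + (a y $ j * h $ j) * sgn y $ i)
            - g' (\<tau> y) * \<tau> y * ((if i = j then h $ i else 0) - sgn y $ i * (sgn y $ j * h $ j))) / (norm y)\<^sup>2)"
          unfolding matrix_vector_mult_def H_def
          by simp (intro sum.cong refl, auto simp: algebra_simps add_divide_distrib diff_divide_distrib)
        also have "\<dots> = (g'' (\<tau> y) * (a y $ i * (\<Sum>j\<in>UNIV. a y $ j * h $ j))
            - g' (\<tau> y) * ((\<Sum>j\<in>UNIV. sgn y $ j * h $ j) * a y $ i + (\<Sum>j\<in>UNIV. a y $ j * h $ j) * sgn y $ i)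
            - g' (\<tau> y) * \<tau> y * ((\<Sum>j\<in>UNIV. if i = j then h $ i else 0) - sgn y $ i * (\<Sum>j\<in>UNIV. sgn y $ j * h $ j))) / (norm y)\<^sup>2"
          by (simp only: sum_divide_distrib[symmetric] sum_subtractf sum.distrib sum_distrib_left[symmetric] sum_distrib_right[symmetric])
        finally show ?thesis by (simp add: inner_vec_def)
      qed
      then show ?thesis
        by (simp add: vec_eq_iff divide_inverse power2_eq_square inner_commute algebra_simps)
    qed
    ultimately show ?thesis by simp
  qed
  have cont: "continuous_on ?S sgn" "continuous_on ?S \<tau>" "continuous_on ?S a"
    unfolding \<tau>_def[abs_def] a_def[abs_def] by (auto intro!: continuous_intros continuous_on_sgn)
  have cg': "continuous_on ?S (\<lambda>y. g' (\<tau> y))"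
    by (rule continuous_on_compose2[OF DERIV_continuous_on[of I g' g'']])
       (use cont \<tau>I g' in \<open>auto intro: has_field_derivative_at_within\<close>)
  have cg'': "continuous_on ?S (\<lambda>y. g'' (\<tau> y))"
    by (rule continuous_on_compose2[OF g'']) (use cont \<tau>I in auto)
  have cG: "continuous_on ?S G"
    unfolding G_def[abs_def] by (intro continuous_intros cg' cont) auto
  have cH: "continuous_on ?S H"
    unfolding H_def[abs_def]
    by (intro continuous_on_vec_lambda continuous_intros cg' cg'' cont) auto
  have sub: "{y. 0 < y $ k} \<subseteq> ?S" by auto
  have "C1_on ?S (\<lambda>y. g (e \<bullet> sgn y))"
    unfolding C1_on_def using cG dG1 has_derivative_at_withinI by blast
  moreover have "C2_on {y. 0 < y $ k} (\<lambda>y. g (e \<bullet> sgn y))"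
    unfolding C2_on_def
  proof (intro exI[of _ G] exI[of _ H] conjI ballI)
    show "continuous_on {y. 0 < y $ k} H" by (rule continuous_on_subset[OF cH sub])
    fix y :: "real^'n" assume "y \<in> {y. 0 < y $ k}"
    then have "y \<in> ?S" using sub by blast
    then show "((\<lambda>y. g (e \<bullet> sgn y)) has_derivative (\<lambda>h. G y \<bullet> h)) (at y within {y. 0 < y $ k})"
      and "(G has_derivative (\<lambda>h. H y *v h)) (at y within {y. 0 < y $ k})"
      using dG1 dG has_derivative_at_withinI by blast+
  qed
  ultimately show "classical_on_hemisphere k (\<lambda>x. g (e \<bullet> x))"
    by (simp add: classical_on_hemisphere_def)
  show "normal_deriv k (\<lambda>x. g (e \<bullet> x)) x = - (g' (e \<bullet> x) * e $ k)" if "x \<in> hemisphere_boundary k"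
  proof -
    have x: "norm x = 1" "x $ k = 0" using that by (auto simp: hemisphere_boundary_def)
    then have "x \<in> ?S" by auto
    then show ?thesis
      using normal_deriv_eq_gradient[of "\<lambda>x. g (e \<bullet> x)", OF dG1, of x k] x
      by (simp add: G_def a_def \<tau>_def sgn_eq_self)
  qed
  show "laplace_beltrami (\<lambda>x. g (e \<bullet> x)) x =
      (e \<bullet> e - (e \<bullet> x)\<^sup>2) * g'' (e \<bullet> x) - (real CARD('n) - 1) * (e \<bullet> x) * g' (e \<bullet> x)" if x: "x \<in> hemisphere k"
  proof -
    have nx: "norm x = 1" and xS: "x \<in> ?S" using x by (auto simp: hemisphere_def)
    have sx: "sgn x = x" using nx by (simp add: sgn_eq_self)
    have xx: "x \<bullet> x = 1" using nx by (simp add: norm_eq_1)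
    have "laplace_beltrami (\<lambda>x. g (e \<bullet> x)) x = trace (H x)"
      by (rule laplace_beltrami_eq_trace[OF x dG1 dG[OF xS]]) auto
    also have "\<dots> = (\<Sum>i\<in>UNIV. g'' (\<tau> x) * (a x $ i * a x $ i)
      - g' (\<tau> x) * (2 * (x $ i * a x $ i)) - g' (\<tau> x) * \<tau> x * (1 - x $ i * x $ i))"
      unfolding trace_def H_def using nx sx by (intro sum.cong refl) (simp add: algebra_simps)
    also have "\<dots> = g'' (\<tau> x) * (a x \<bullet> a x) - g' (\<tau> x) * (2 * (x \<bullet> a x)) - g' (\<tau> x) * \<tau> x * (real CARD('n) - x \<bullet> x)"
      by (simp only: inner_vec_def inner_real_def sum_subtractf sum.distrib sum_distrib_left[symmetric] sum_constant) simp
    also have "a x \<bullet> a x = e \<bullet> e - (e \<bullet> x)\<^sup>2"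
      by (simp add: a_def \<tau>_def sx inner_diff_left inner_diff_right xx inner_commute power2_eq_square)
    also have "x \<bullet> a x = 0"
      by (simp add: a_def \<tau>_def sx inner_diff_right xx inner_commute)
    finally show ?thesis by (simp add: xx \<tau>_def sx algebra_simps)
  qed
qed

section \<open>Reflections and comparison\<close>

lemma classical_continuous_on:
  assumes "classical_on_hemisphere k f"
  shows "continuous_on (closed_hemisphere k) f"
proof -
  let ?S = "{x::real^'a. x $ k \<ge> 0} - {0}"
  obtain G where "\<And>y. y \<in> ?S \<Longrightarrow> ((\<lambda>y. f (sgn y)) has_derivative (\<lambda>h. G y \<bullet> h)) (at y within ?S)"
    using assms unfolding classical_on_hemisphere_def C1_on_def by blast
  then have "continuous_on ?S (\<lambda>y. f (sgn y))"
    by (rule has_derivative_continuous_on)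
  then have "continuous_on (closed_hemisphere k) (\<lambda>y. f (sgn y))"
    by (rule continuous_on_subset) (auto simp: closed_hemisphere_iff)
  then show ?thesis
    by (rule continuous_on_eq) (auto simp: closed_hemisphere_iff sgn_eq_self)
qed

lemma compact_closed_hemisphere: "compact (closed_hemisphere k)"
proof -
  have "closed_hemisphere k = sphere 0 1 \<inter> {x. 0 \<le> x $ k}"
    by (auto simp: closed_hemisphere_iff)
  moreover have "closed {x::real^'a. 0 \<le> x $ k}"
    by (intro closed_Collect_le continuous_intros)
  ultimately show ?thesis by (simp add: compact_Int_closed)
qed

text \<open>Solutions are cut off to 0 outside the closed hemisphere, ridge functions are not. Since
  \<open>sgn\<close> maps the punctured closed half-space into the closed hemisphere, regularity and
  both operators see only values there.\<close>

lemma
  fixes f g :: "real^'n \<Rightarrow> real"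
  assumes f: "classical_on_hemisphere k f" and eq: "\<And>x. x \<in> closed_hemisphere k \<Longrightarrow> g x = f x"
  shows classical_cong: "classical_on_hemisphere k g"
    and laplace_beltrami_cong: "x \<in> hemisphere k \<Longrightarrow> laplace_beltrami g x = laplace_beltrami f x"
    and normal_deriv_cong: "x \<in> hemisphere_boundary k \<Longrightarrow> normal_deriv k g x = normal_deriv k f x"
proof -
  have eq': "g (sgn y) = f (sgn y)" if "y \<in> {x. x $ k \<ge> 0} - {0}" for y
    using eq sgn_in_closed_hemisphere[OF that] by blast
  obtain G H where cH: "continuous_on {y. 0 < y $ k} H"
    and G: "\<And>y. 0 < y $ k \<Longrightarrow> ((\<lambda>y. f (sgn y)) has_derivative (\<lambda>h. G y \<bullet> h)) (at y)"
    and H: "\<And>y. 0 < y $ k \<Longrightarrow> (G has_derivative (\<lambda>h. H y *v h)) (at y)"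
    using f C2_on_halfspaceE unfolding classical_on_hemisphere_def by metis
  have G': "((\<lambda>y. g (sgn y)) has_derivative (\<lambda>h. G y \<bullet> h)) (at y)" if "0 < y $ k" for y
    by (rule has_derivative_transform_within_open[OF G[OF that] open_upper_halfspace[of k]])
       (use that eq' in \<open>auto intro!: eq'[symmetric]\<close>)
  have "C2_on {y. 0 < y $ k} (\<lambda>y. g (sgn y))"
    by (rule C2_on_halfspaceI[OF cH G' H])
  moreover have "C1_on ({x. x $ k \<ge> 0} - {0}) (\<lambda>y. g (sgn y))"
  proof -
    let ?S = "{x::real^'n. x $ k \<ge> 0} - {0}"
    obtain g1 where g1: "continuous_on ?S g1"
      "\<And>y. y \<in> ?S \<Longrightarrow> ((\<lambda>y. f (sgn y)) has_derivative (\<lambda>h. g1 y \<bullet> h)) (at y within ?S)"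
      using f unfolding classical_on_hemisphere_def C1_on_def by blast
    have "((\<lambda>y. g (sgn y)) has_derivative (\<lambda>h. g1 y \<bullet> h)) (at y within ?S)" if "y \<in> ?S" for y
      by (rule has_derivative_transform[OF that eq' g1(2)[OF that]])
    then show ?thesis unfolding C1_on_def using g1(1) by blast
  qed
  ultimately show "classical_on_hemisphere k g"
    by (simp add: classical_on_hemisphere_def)
  show "laplace_beltrami g x = laplace_beltrami f x" if "x \<in> hemisphere k"
  proof -
    have "0 < x $ k" using that by (simp add: hemisphere_def)
    then show ?thesis
      using laplace_beltrami_eq_trace[OF that G H] laplace_beltrami_eq_trace[OF that G' H] by simp
  qed
  show "normal_deriv k g x = normal_deriv k f x" if x: "x \<in> hemisphere_boundary k"
    by (rule normal_deriv_eqI, rule has_field_derivative_transform_within[OF has_normal_deriv[OF f x] zero_less_one])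
       (use boundary_ray[OF x] eq' in auto)
qed

section \<open>Hyperplane reflections\<close>

definition reflect :: "'a::real_inner \<Rightarrow> 'a \<Rightarrow> 'a" where
  "reflect e y = y - (2 * (e \<bullet> y)) *\<^sub>R e"

lemma linear_reflect: "linear (reflect e)"
  by (rule linearI) (simp_all add: reflect_def inner_add_right algebra_simps)

lemma reflect_adjoint: "reflect e x \<bullet> y = x \<bullet> reflect e y"
  by (simp add: reflect_def inner_diff_left inner_diff_right inner_commute)

lemma reflect_involution: "e \<bullet> e = 1 \<Longrightarrow> reflect e (reflect e y) = y"
  by (simp add: reflect_def inner_diff_right algebra_simps)

lemma norm_reflect: "e \<bullet> e = 1 \<Longrightarrow> norm (reflect e y) = norm y"
  by (simp add: norm_eq_sqrt_inner reflect_adjoint reflect_involution)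

lemma sgn_reflect: "e \<bullet> e = 1 \<Longrightarrow> sgn (reflect e y) = reflect e (sgn y)"
  by (simp add: sgn_div_norm norm_reflect linear_scale[OF linear_reflect])

lemma reflect_nth: "e $ k = 0 \<Longrightarrow> reflect e y $ k = y $ k"
  by (simp add: reflect_def)

lemma reflect_fixed: "e \<bullet> y = 0 \<Longrightarrow> reflect e y = y"
  by (simp add: reflect_def)

text \<open>For horizontal \<open>e\<close> the reflection \<open>R\<close> is an orthogonal
  involution that preserves the half-space and fixes the axis. The gradient becomes
  \<open>R G(R y)\<close>, the Hessian \<open>R H(R y) R\<close>, and conjugation preserves the
  trace.\<close>

lemma
  fixes f :: "real^'n \<Rightarrow> real"
  assumes f: "classical_on_hemisphere k f" and e: "e \<bullet> e = 1" "e $ k = 0"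
  shows classical_reflect: "classical_on_hemisphere k (\<lambda>x. f (reflect e x))"
    and laplace_beltrami_reflect: "x \<in> hemisphere k \<Longrightarrow>
      laplace_beltrami (\<lambda>x. f (reflect e x)) x = laplace_beltrami f (reflect e x)"
    and normal_deriv_reflect: "x \<in> hemisphere_boundary k \<Longrightarrow>
      normal_deriv k (\<lambda>x. f (reflect e x)) x = normal_deriv k f (reflect e x)"
proof -
  let ?\<rho> = "reflect e" and ?R = "matrix (reflect e)"
  have R: "?R *v h = ?\<rho> h" for h
    using matrix_vector_mul(2)[OF linear_reflect[of e]] by metis
  have RR: "?R ** ?R = mat 1"
    by (simp add: matrix_eq R reflect_involution[OF e(1)] flip: matrix_vector_mul_assoc)
  have d\<rho>: "(?\<rho> has_derivative ?\<rho>) (at y within S)" for y S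
    using linear_reflect linear_linear bounded_linear_imp_has_derivative by blast
  have n0: "?\<rho> y \<noteq> 0" if "y \<noteq> 0" for y
    using norm_reflect[OF e(1), of y] that by auto
  obtain G H where cH: "continuous_on {y. 0 < y $ k} H"
    and G: "\<And>y. 0 < y $ k \<Longrightarrow> ((\<lambda>y. f (sgn y)) has_derivative (\<lambda>h. G y \<bullet> h)) (at y)"
    and H: "\<And>y. 0 < y $ k \<Longrightarrow> (G has_derivative (\<lambda>h. H y *v h)) (at y)"
    using f C2_on_halfspaceE unfolding classical_on_hemisphere_def by metis
  define G' where "G' y = ?\<rho> (G (?\<rho> y))" for y
  define H' where "H' y = ?R ** (H (?\<rho> y) ** ?R)" for y
  have G': "((\<lambda>y. f (?\<rho> (sgn y))) has_derivative (\<lambda>h. G' y \<bullet> h)) (at y)" if "0 < y $ k" for y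
    using has_derivative_compose[OF d\<rho> G, of y UNIV] that
    by (simp add: reflect_nth e G'_def reflect_adjoint sgn_reflect)
  have H': "(G' has_derivative (\<lambda>h. H' y *v h)) (at y)" if "0 < y $ k" for y
    unfolding G'_def[abs_def]
    using has_derivative_compose[OF has_derivative_compose[OF d\<rho> H, of y UNIV] d\<rho>] that
    by (simp add: reflect_nth e H'_def R flip: matrix_vector_mul_assoc)
  have cont: "continuous_on S ?\<rho>" for S
    by (rule has_derivative_continuous_on[OF d\<rho>])
  have "continuous_on {y. 0 < y $ k} (\<lambda>y. H (?\<rho> y))"
    by (rule continuous_on_compose2[OF cH cont]) (auto simp: reflect_nth e)
  then have "continuous_on {y. 0 < y $ k} H'"
    unfolding H'_def[abs_def] matrix_matrix_mult_def
    by (intro continuous_on_vec_lambda continuous_intros) simp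
  then have "C2_on {y. 0 < y $ k} (\<lambda>y. f (?\<rho> (sgn y)))"
    by (rule C2_on_halfspaceI[OF _ G' H'])
  moreover have "C1_on ({x. x $ k \<ge> 0} - {0}) (\<lambda>y. f (?\<rho> (sgn y)))"
  proof -
    let ?S = "{x::real^'n. x $ k \<ge> 0} - {0}"
    have S: "?\<rho> y \<in> ?S" if "y \<in> ?S" for y
      using that n0 by (auto simp: reflect_nth e)
    obtain g where cg: "continuous_on ?S g"
      and g: "\<And>y. y \<in> ?S \<Longrightarrow> ((\<lambda>y. f (sgn y)) has_derivative (\<lambda>h. g y \<bullet> h)) (at y within ?S)"
      using f unfolding classical_on_hemisphere_def C1_on_def by blast
    have "continuous_on ?S (\<lambda>y. ?\<rho> (g (?\<rho> y)))"
      by (rule continuous_on_compose2[OF cont continuous_on_compose2[OF cg cont]]) (use S in auto)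
    moreover have "((\<lambda>y. f (?\<rho> (sgn y))) has_derivative (\<lambda>h. ?\<rho> (g (?\<rho> y)) \<bullet> h)) (at y within ?S)"
      if "y \<in> ?S" for y
    proof -
      have "((\<lambda>y. f (sgn (?\<rho> y))) has_derivative (\<lambda>h. g (?\<rho> y) \<bullet> ?\<rho> h)) (at y within ?S)"
        by (rule has_derivative_in_compose[OF d\<rho>])
           (use g[OF S[OF that]] S in \<open>auto intro: has_derivative_subset\<close>)
      then show ?thesis by (simp add: reflect_adjoint sgn_reflect e)
    qed
    ultimately show ?thesis unfolding C1_on_def by blast
  qed
  ultimately show "classical_on_hemisphere k (\<lambda>x. f (?\<rho> x))"
    by (simp add: classical_on_hemisphere_def)
  show "laplace_beltrami (\<lambda>x. f (?\<rho> x)) x = laplace_beltrami f (?\<rho> x)" if x: "x \<in> hemisphere k"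
  proof -
    have xk: "0 < x $ k" and \<rho>x: "?\<rho> x \<in> hemisphere k"
      using x by (auto simp: hemisphere_def norm_reflect reflect_nth e)
    then have "laplace_beltrami f (?\<rho> x) = trace (H (?\<rho> x))"
      by (intro laplace_beltrami_eq_trace[OF \<rho>x G H]) (auto simp: reflect_nth e)
    moreover have "laplace_beltrami (\<lambda>x. f (?\<rho> x)) x = trace (H' x)"
      by (rule laplace_beltrami_eq_trace[OF x G' H'[OF xk]])
    moreover have "trace (H' x) = trace (H (?\<rho> x))"
      unfolding H'_def by (subst trace_mul_sym) (simp add: RR flip: matrix_mul_assoc)
    ultimately show ?thesis by simp
  qed
  show "normal_deriv k (\<lambda>x. f (?\<rho> x)) x = normal_deriv k f (?\<rho> x)"
  proof -
    have "?\<rho> (axis k 1) = axis k 1" using e(2) by (intro reflect_fixed) (simp add: inner_axis)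
    then have "?\<rho> (x + t *\<^sub>R (- axis k 1)) = ?\<rho> x + t *\<^sub>R (- axis k 1)" for t
      by (simp add: linear_diff[OF linear_reflect] linear_scale[OF linear_reflect])
    then show ?thesis
      unfolding normal_deriv_def by (simp add: e flip: sgn_reflect)
  qed
qed

text \<open>All barriers except the exponential one belong to this family: \<open>d > 0\<close>
  makes the supersolutions strict where \<open>e \<bullet> x = 0\<close>, and \<open>d = 0\<close>
  is the affine case. For horizontal \<open>e\<close> the normal derivative is zero.\<close>

lemma
  fixes e :: "real^'n"
  assumes e: "e \<bullet> e = 1"
  shows classical_quadratic_ridge: "classical_on_hemisphere k (\<lambda>x. c + e \<bullet> x - d * (e \<bullet> x)\<^sup>2)"
    and laplace_beltrami_quadratic_ridge: "x \<in> hemisphere k \<Longrightarrow>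
      laplace_beltrami (\<lambda>x. c + e \<bullet> x - d * (e \<bullet> x)\<^sup>2) x
        = - 2 * d * (1 - (e \<bullet> x)\<^sup>2) - (real CARD('n) - 1) * (e \<bullet> x) * (1 - 2 * d * (e \<bullet> x))"
    and normal_deriv_quadratic_ridge: "x \<in> hemisphere_boundary k \<Longrightarrow>
      normal_deriv k (\<lambda>x. c + e \<bullet> x - d * (e \<bullet> x)\<^sup>2) x = - ((1 - 2 * d * (e \<bullet> x)) * e $ k)"
proof -
  have 1: "((\<lambda>t. c + t - d * t\<^sup>2) has_real_derivative 1 - 2 * d * t) (at t)" for t
    by (auto intro!: derivative_eq_intros)
  have 2: "((\<lambda>t. 1 - 2 * d * t) has_real_derivative - 2 * d) (at t)" for t
    by (auto intro!: derivative_eq_intros)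
  note ridge = open_UNIV UNIV_I 1 2 continuous_on_const
  show "classical_on_hemisphere k (\<lambda>x. c + e \<bullet> x - d * (e \<bullet> x)\<^sup>2)"
    by (rule classical_ridge[OF ridge])
  show "laplace_beltrami (\<lambda>x. c + e \<bullet> x - d * (e \<bullet> x)\<^sup>2) x
        = - 2 * d * (1 - (e \<bullet> x)\<^sup>2) - (real CARD('n) - 1) * (e \<bullet> x) * (1 - 2 * d * (e \<bullet> x))"
    if "x \<in> hemisphere k"
    using laplace_beltrami_ridge[OF ridge that, of e] e by simp
  show "normal_deriv k (\<lambda>x. c + e \<bullet> x - d * (e \<bullet> x)\<^sup>2) x = - ((1 - 2 * d * (e \<bullet> x)) * e $ k)"
    if "x \<in> hemisphere_boundary k"
    using normal_deriv_ridge[OF ridge that, of e] by simp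
qed

section \<open>Maximal ratios and touching from above\<close>

lemma max_ratio:
  fixes w \<Phi> :: "'a::metric_space \<Rightarrow> real"
  assumes "compact K" "continuous_on K w" "continuous_on K \<Phi>" "\<And>x. x \<in> K \<Longrightarrow> 0 < \<Phi> x"
    and "z \<in> K" "0 < w z"
  obtains x M where "x \<in> K" "w z / \<Phi> z \<le> M" "0 < M" "w x = M * \<Phi> x" "\<And>y. y \<in> K \<Longrightarrow> w y \<le> M * \<Phi> y"
proof -
  have "continuous_on K (\<lambda>x. w x / \<Phi> x)"
    using assms by (intro continuous_intros) (auto simp: less_imp_neq[symmetric])
  then obtain x where x: "x \<in> K" "\<And>y. y \<in> K \<Longrightarrow> w y / \<Phi> y \<le> w x / \<Phi> x"
    using continuous_attains_sup[of K "\<lambda>x. w x / \<Phi> x"] assms by auto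
  have "0 < w z / \<Phi> z" using assms by simp
  \<comment> \<open>\<open>M\<close> is the maximal ratio, so \<open>M * \<Phi>\<close> touches
    \<open>w\<close> from above at \<open>x\<close>; the bound from below by the ratio at
    \<open>z\<close> serves the quantitative estimates on the equator.\<close>
  show ?thesis
  proof
    show "w z / \<Phi> z \<le> w x / \<Phi> x" by (rule x(2)[OF assms(5)])
    then show "0 < w x / \<Phi> x" using \<open>0 < w z / \<Phi> z\<close> by simp
    show "w x = w x / \<Phi> x * \<Phi> x" using assms(4)[OF x(1)] by simp
    show "w y \<le> w x / \<Phi> x * \<Phi> y" if "y \<in> K" for y
      using x(2)[OF that] assms(4)[OF that] by (simp add: pos_divide_le_eq)
  qed (rule x(1))
qed

text \<open>At the touching point the difference has a maximum, which compares the Laplacians, while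
  the equal values cancel the zeroth-order terms. The argument therefore works for either sign of
  \<open>l\<close>.\<close>

lemma no_interior_touching:
  assumes "classical_on_hemisphere k f" "classical_on_hemisphere k \<Phi>" and x: "x \<in> hemisphere k"
    and "open U" "x \<in> U" and le: "\<And>y. y \<in> U \<Longrightarrow> y \<in> hemisphere k \<Longrightarrow> f y \<le> M * \<Phi> y"
    and eq: "f x = M * \<Phi> x" and "0 < M"
    and f: "0 \<le> laplace_beltrami f x + l * f x" and \<Phi>: "laplace_beltrami \<Phi> x + l * \<Phi> x < 0"
  shows False
proof -
  have "laplace_beltrami (\<lambda>x. 1 * f x + (- M) * \<Phi> x) x \<le> 0"
    by (rule laplace_beltrami_nonpos_at_local_max[OF classical_lincomb(1) x, where U = U]) (use assms in auto)
  then have "laplace_beltrami f x \<le> M * laplace_beltrami \<Phi> x"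
    using classical_lincomb(2)[of k f \<Phi> x 1 "- M"] assms by simp
  moreover have "M * (laplace_beltrami \<Phi> x + l * \<Phi> x) < 0"
    using \<Phi> \<open>0 < M\<close> by (simp add: mult_pos_neg)
  ultimately show False using f eq by (simp add: algebra_simps)
qed

lemma normal_deriv_boundary_touching:
  assumes "classical_on_hemisphere k f" "classical_on_hemisphere k \<Phi>" and x: "x \<in> hemisphere_boundary k"
    and "open U" "x \<in> U" and le: "\<And>y. y \<in> U \<Longrightarrow> y \<in> closed_hemisphere k \<Longrightarrow> f y \<le> M * \<Phi> y"
    and eq: "f x = M * \<Phi> x"
  shows "M * normal_deriv k \<Phi> x \<le> normal_deriv k f x"
proof -
  have "0 \<le> normal_deriv k (\<lambda>x. 1 * f x + (- M) * \<Phi> x) x"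
    by (rule normal_deriv_nonneg_at_local_max[OF classical_lincomb(1) x, where U = U]) (use assms in auto)
  then show ?thesis
    using normal_deriv_lincomb[of k f \<Phi> x 1 "- M"] assms by simp
qed

lemma signed_power_strict_mono:
  fixes a b p :: real
  assumes "a < b" "1 < p"
  shows "\<bar>a\<bar> powr (p - 1) * a < \<bar>b\<bar> powr (p - 1) * b"
proof -
  have *: "\<bar>a\<bar> powr (p - 1) * a < \<bar>b\<bar> powr (p - 1) * b" if "0 \<le> a" "a < b" for a b :: real
  proof -
    have "a powr (p - 1) * a \<le> b powr (p - 1) * a"
      using that \<open>1 < p\<close> by (intro mult_right_mono powr_mono2) auto
    also have "\<dots> < b powr (p - 1) * b"
      using that by (intro mult_strict_left_mono) auto
    finally show ?thesis using that by simp
  qed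
  consider "0 \<le> a" | "a < 0" "0 \<le> b" | "b < 0" by linarith
  then show ?thesis
  proof cases
    case 2
    then have "\<bar>a\<bar> powr (p - 1) * a < 0" by (simp add: mult_pos_neg)
    then show ?thesis using 2 by (meson less_le_trans mult_nonneg_nonneg powr_ge_zero)
  next
    case 3
    \<comment> \<open>By oddness two negative arguments reduce to a positive pair.\<close>
    then show ?thesis using *[of "- b" "- a"] assms by simp
  qed (use * assms in simp)
qed

section \<open>Basic properties of the solution set\<close>

lemma solutionsD:
  fixes \<omega> :: "real^'n \<Rightarrow> real"
  assumes "\<omega> \<in> solutions k p"
  shows "classical_on_hemisphere k \<omega>" and "x \<notin> closed_hemisphere k \<Longrightarrow> \<omega> x = 0"
    and "x \<in> hemisphere k \<Longrightarrow> laplace_beltrami \<omega> x + ell CARD('n) p * \<omega> x = 0"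
    and "x \<in> hemisphere_boundary k \<Longrightarrow> normal_deriv k \<omega> x = - (\<bar>\<omega> x\<bar> powr (p - 1) * \<omega> x)"
  using assms by (auto simp: solutions_def eq_neg_iff_add_eq_0)

lemma classical_zero: "classical_on_hemisphere k (\<lambda>x. 0)"
  using classical_ridge[of UNIV k 0 "\<lambda>t. 0" "\<lambda>t. 0" "\<lambda>t. 0"] by simp

lemma zero_in_solutions: "(\<lambda>x. 0) \<in> solutions k p"
  using laplace_beltrami_ridge[of UNIV k 0 "\<lambda>t. 0" "\<lambda>t. 0" "\<lambda>t. 0"]
    normal_deriv_ridge[of UNIV k 0 "\<lambda>t. 0" "\<lambda>t. 0" "\<lambda>t. 0"]
  by (simp add: solutions_def classical_zero)

lemma solutions_uminus:
  assumes "\<omega> \<in> solutions k p"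
  shows "(\<lambda>x. - \<omega> x) \<in> solutions k p"
  using classical_lincomb(1)[OF solutionsD(1)[OF assms] solutionsD(1)[OF assms], of "-1" 0]
    normal_deriv_lincomb[OF solutionsD(1)[OF assms] solutionsD(1)[OF assms], of _ "-1" 0] assms
    classical_lincomb(2)[OF solutionsD(1)[OF assms] solutionsD(1)[OF assms], of _ "-1" 0]
  by (auto simp: solutions_def)

lemma solutions_eqI:
  assumes "\<omega> \<in> solutions k p" "\<omega>' \<in> solutions k p" "\<And>x. x \<in> closed_hemisphere k \<Longrightarrow> \<omega> x = \<omega>' x"
  shows "\<omega> = \<omega>'"
  using assms solutionsD(2) by (metis ext)

section \<open>The range of nonpositive or intermediate coefficients\<close>

lemma axis_inner: "axis k (1::real) \<bullet> x = x $ k" "axis k (1::real) \<bullet> axis k 1 = 1"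
  by (simp_all add: inner_axis')

lemma abs_inner_le_1: "e \<bullet> e = 1 \<Longrightarrow> norm x = 1 \<Longrightarrow> \<bar>e \<bullet> x\<bar> \<le> 1"
  using Cauchy_Schwarz_ineq2[of e x] by (simp add: norm_eq_sqrt_inner)

text \<open>For \<open>c = d = 0\<close> the expression is \<open>- (n - 1 - l) * t\<close>, which
  degenerates at \<open>t = 0\<close>. The quadratic term adds \<open>- 2 * d\<close> there, and
  \<open>c = d / l\<close> makes the profile positive at the cost of only \<open>d\<close>.\<close>

lemma strict_supersolution_profile:
  fixes n l :: real
  assumes "0 < l" "l < n - 1"
  obtains c d where "\<And>t. 0 \<le> t \<Longrightarrow> t \<le> 1 \<Longrightarrow> 0 < c + t - d * t\<^sup>2"
    and "\<And>t. 0 \<le> t \<Longrightarrow> t \<le> 1 \<Longrightarrow>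
      - 2 * d * (1 - t\<^sup>2) - (n - 1) * t * (1 - 2 * d * t) + l * (c + t - d * t\<^sup>2) < 0"
proof
  \<comment> \<open>The bound 1 keeps \<open>d * t\<^sup>2\<close> at most \<open>t\<close>; the
    other one lets \<open>(n - 1 - l) * t\<close> absorb
    \<open>2 * n * d * t\<^sup>2\<close>.\<close>
  define d where "d = min 1 ((n - 1 - l) / (2 * n))"
  have n: "0 < n" using assms by simp
  have d: "0 < d" "d \<le> 1" using assms by (auto simp: d_def)
  have "d * (2 * n) \<le> n - 1 - l"
    using n by (simp add: d_def min_mult_distrib_right min_le_iff_disj)
  fix t :: real assume t: "0 \<le> t" "t \<le> 1"
  have t2: "t\<^sup>2 \<le> t" using t by (simp add: power2_eq_square mult_left_le)
  have "d * t\<^sup>2 \<le> 1 * t" using d t2 t by (intro mult_mono) auto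
  then show "0 < d / l + t - d * t\<^sup>2" using d assms by (smt (verit) divide_pos_pos)
  have "2 * n * d * t\<^sup>2 \<le> 2 * n * d * t"
    using t2 n d by (intro mult_left_mono) auto
  also have "\<dots> \<le> (n - 1 - l) * t"
    using \<open>d * (2 * n) \<le> n - 1 - l\<close> t by (intro mult_right_mono) (auto simp: mult.commute)
  moreover have "0 \<le> l * d * t\<^sup>2" using assms d by simp
  moreover have "- 2 * d * (1 - t\<^sup>2) - (n - 1) * t * (1 - 2 * d * t) + l * (d / l + t - d * t\<^sup>2)
      = - d - (n - 1 - l) * t + 2 * n * d * t\<^sup>2 - l * d * t\<^sup>2"
    using assms by (simp add: field_simps power2_eq_square)
  ultimately show "- 2 * d * (1 - t\<^sup>2) - (n - 1) * t * (1 - 2 * d * t) + l * (d / l + t - d * t\<^sup>2) < 0"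
    using d by linarith
qed

text \<open>\<open>N - 1\<close> is the first Dirichlet eigenvalue of the hemisphere, with
  eigenfunction \<open>x $ k\<close>. Below it the vertical barrier is a strict supersolution that
  is positive up to the equator. A positive maximum of \<open>f / \<Phi>\<close> cannot lie on the
  equator, so it is an interior touching.\<close>

lemma dirichlet_comparison:
  fixes f :: "real^'n \<Rightarrow> real"
  assumes f: "classical_on_hemisphere k f" and l: "0 < l" "l < real CARD('n) - 1"
    and eq: "\<And>x. x \<in> hemisphere k \<Longrightarrow> laplace_beltrami f x + l * f x = 0"
    and bd: "\<And>x. x \<in> hemisphere_boundary k \<Longrightarrow> f x \<le> 0"
    and z: "z \<in> closed_hemisphere k"
  shows "f z \<le> 0"
proof (rule ccontr)
  assume "\<not> f z \<le> 0"
  then have fz: "0 < f z" by simp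
  obtain c d where pos: "\<And>t. 0 \<le> t \<Longrightarrow> t \<le> 1 \<Longrightarrow> 0 < c + t - d * t\<^sup>2"
    and super: "\<And>t. 0 \<le> t \<Longrightarrow> t \<le> 1 \<Longrightarrow>
      - 2 * d * (1 - t\<^sup>2) - (real CARD('n) - 1) * t * (1 - 2 * d * t) + l * (c + t - d * t\<^sup>2) < 0"
    using strict_supersolution_profile[OF l] by blast
  define \<Phi> where "\<Phi> x = c + axis k 1 \<bullet> x - d * (axis k 1 \<bullet> x)\<^sup>2" for x :: "real^'n"
  have c\<Phi>: "classical_on_hemisphere k \<Phi>"
    unfolding \<Phi>_def[abs_def] by (rule classical_quadratic_ridge[OF axis_inner(2)])
  have range: "0 \<le> axis k 1 \<bullet> x" "axis k 1 \<bullet> x \<le> 1" if "x \<in> closed_hemisphere k" for x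
    using that abs_inner_le_1[OF axis_inner(2), of x k] by (auto simp: closed_hemisphere_iff axis_inner)
  obtain x M where x: "x \<in> closed_hemisphere k" "0 < M" "f x = M * \<Phi> x"
    and le: "\<And>y. y \<in> closed_hemisphere k \<Longrightarrow> f y \<le> M * \<Phi> y"
    by (rule max_ratio[OF compact_closed_hemisphere classical_continuous_on[OF f]
          classical_continuous_on[OF c\<Phi>] _ z fz]) (use pos range in \<open>auto simp: \<Phi>_def\<close>)
  have "0 < f x" using x pos range by (simp add: \<Phi>_def)
  then have xh: "x \<in> hemisphere k" using bd[of x] x(1) by (auto simp: closed_hemisphere_def)
  show False
  proof (rule no_interior_touching[OF f c\<Phi> xh open_UNIV UNIV_I])
    show "f y \<le> M * \<Phi> y" if "y \<in> hemisphere k" for y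
      using le[of y] that by (simp add: closed_hemisphere_def)
    show "0 \<le> laplace_beltrami f x + l * f x" using eq[OF xh] by simp
    show "laplace_beltrami \<Phi> x + l * \<Phi> x < 0"
      using laplace_beltrami_quadratic_ridge[OF axis_inner(2) xh, where c = c and d = d] super range[OF x(1)]
      by (simp add: \<Phi>_def[abs_def])
  qed (rule x)+
qed

text \<open>The reflection in \<open>e\<close> swaps \<open>x\<close> and \<open>y\<close>; the odd part of a solution is compared on the
  quarter sphere \<open>e \<bullet> z \<ge> 0\<close> with a supersolution that depends on \<open>e \<bullet> z\<close> only, hence has zero
  normal derivative on the equator, where the boundary nonlinearity is strictly increasing.\<close>

lemma solution_le_on_latitude:
  fixes \<omega> :: "real^'n \<Rightarrow> real"
  assumes \<omega>: "\<omega> \<in> solutions k p" and p: "1 < p"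
    and l: "0 < ell CARD('n) p" "ell CARD('n) p < real CARD('n) - 1"
    and x: "x \<in> closed_hemisphere k" and y: "y \<in> closed_hemisphere k" and xy: "x $ k = y $ k"
  shows "\<omega> x \<le> \<omega> y"
proof (rule ccontr)
  let ?l = "ell CARD('n) p"
  assume "\<not> \<omega> x \<le> \<omega> y"
  then have less: "\<omega> y < \<omega> x" by simp
  then have "x \<noteq> y" by auto
  \<comment> \<open>The unit normal of the perpendicular bisector of \<open>x\<close> and
    \<open>y\<close>, which contains the origin as both have norm 1; it is horizontal because their
    heights agree.\<close>
  define e where "e = (x - y) /\<^sub>R norm (x - y)"
  have e: "e \<bullet> e = 1" "e $ k = 0"
    using \<open>x \<noteq> y\<close> xy by (auto simp: e_def dot_square_norm power2_eq_square)
  have xx: "x \<bullet> x = 1" "y \<bullet> y = 1" using x y by (auto simp: closed_hemisphere_iff norm_eq_1)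
  have nn: "(norm (x - y))\<^sup>2 = 2 * ((x - y) \<bullet> x)"
    using xx by (simp add: power2_norm_eq_inner inner_diff_left inner_diff_right inner_commute)
  have ex: "e \<bullet> x = norm (x - y) / 2"
    using nn \<open>x \<noteq> y\<close> by (simp add: e_def inverse_eq_divide divide_eq_eq power2_eq_square)
  then have refl_x: "reflect e x = y"
    using \<open>x \<noteq> y\<close> unfolding reflect_def ex by (simp add: e_def)
  define K where "K = closed_hemisphere k \<inter> {z. 0 \<le> e \<bullet> z}"
  have "compact K"
    unfolding K_def by (intro compact_Int_closed compact_closed_hemisphere closed_Collect_le continuous_intros)
  have "0 \<le> e \<bullet> x" unfolding ex by simp
  then have xK: "x \<in> K" using x by (simp add: K_def)
  note c\<omega> = solutionsD(1)[OF \<omega>]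
  note c\<rho> = classical_reflect[OF c\<omega> e]
  define w where "w z = 1 * \<omega> z + (- 1) * \<omega> (reflect e z)" for z
  have cw: "classical_on_hemisphere k w"
    unfolding w_def[abs_def] by (rule classical_lincomb(1)[OF c\<omega> c\<rho>])
  have wx: "0 < w x" using less by (simp add: w_def refl_x)
  obtain c d where pos: "\<And>t. 0 \<le> t \<Longrightarrow> t \<le> 1 \<Longrightarrow> 0 < c + t - d * t\<^sup>2"
    and super: "\<And>t. 0 \<le> t \<Longrightarrow> t \<le> 1 \<Longrightarrow>
      - 2 * d * (1 - t\<^sup>2) - (real CARD('n) - 1) * t * (1 - 2 * d * t) + ?l * (c + t - d * t\<^sup>2) < 0"
    using strict_supersolution_profile[OF l] by blast
  define \<Phi> where "\<Phi> x = c + e \<bullet> x - d * (e \<bullet> x)\<^sup>2" for x :: "real^'n"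
  have c\<Phi>: "classical_on_hemisphere k \<Phi>"
    unfolding \<Phi>_def[abs_def] by (rule classical_quadratic_ridge[OF e(1)])
  have range: "0 \<le> e \<bullet> z" "e \<bullet> z \<le> 1" if "z \<in> K" for z
    using that abs_inner_le_1[OF e(1), of z] by (auto simp: K_def closed_hemisphere_iff)
  have KC: "K \<subseteq> closed_hemisphere k" by (auto simp: K_def)
  obtain z M where z: "z \<in> K" "0 < M" "w z = M * \<Phi> z"
    and le: "\<And>y. y \<in> K \<Longrightarrow> w y \<le> M * \<Phi> y"
    by (rule max_ratio[OF \<open>compact K\<close> continuous_on_subset[OF classical_continuous_on[OF cw] KC]
          continuous_on_subset[OF classical_continuous_on[OF c\<Phi>] KC] _ xK wx])
       (use pos range in \<open>auto simp: \<Phi>_def\<close>)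
  have wz: "0 < w z" using z pos range by (simp add: \<Phi>_def)
  \<comment> \<open>On \<open>e \<bullet> z = 0\<close> the reflection fixes \<open>z\<close> and
    the odd part vanishes. The maximum is thus off this face, and inside
    \<open>{z. 0 < e \<bullet> z}\<close> the set \<open>K\<close> is the whole closed
    hemisphere.\<close>
  have "e \<bullet> z \<noteq> 0"
    using wz by (auto simp: w_def reflect_fixed)
  then have zU: "z \<in> {z. 0 < e \<bullet> z}" using range[OF z(1)] by simp
  have U: "open {z. 0 < e \<bullet> z}" by (intro open_Collect_less continuous_intros)
  from z(1) consider "z \<in> hemisphere k" | "z \<in> hemisphere_boundary k"
    by (auto simp: K_def closed_hemisphere_def)
  then show False
  proof cases
    case 1
    have \<rho>z: "reflect e z \<in> hemisphere k"
      using 1 by (simp add: hemisphere_def norm_reflect reflect_nth e)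
    show False
    proof (rule no_interior_touching[OF cw c\<Phi> 1 U zU])
      show "w y \<le> M * \<Phi> y" if "y \<in> {z. 0 < e \<bullet> z}" "y \<in> hemisphere k" for y
        using le[of y] that by (simp add: K_def closed_hemisphere_def)
      have "laplace_beltrami w z = laplace_beltrami \<omega> z - laplace_beltrami \<omega> (reflect e z)"
        unfolding w_def[abs_def] using classical_lincomb(2)[OF c\<omega> c\<rho> 1, of 1 "- 1"]
        by (simp add: laplace_beltrami_reflect[OF c\<omega> e 1])
      then show "0 \<le> laplace_beltrami w z + ?l * w z"
        using solutionsD(3)[OF \<omega> 1] solutionsD(3)[OF \<omega> \<rho>z] by (simp add: w_def algebra_simps)
      show "laplace_beltrami \<Phi> z + ?l * \<Phi> z < 0"
        using laplace_beltrami_quadratic_ridge[OF e(1) 1, where c = c and d = d] super range[OF z(1)]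
        by (simp add: \<Phi>_def[abs_def])
    qed (rule z)+
  next
    case 2
    have \<rho>z: "reflect e z \<in> hemisphere_boundary k"
      using 2 by (simp add: hemisphere_boundary_def norm_reflect reflect_nth e)
    have "M * normal_deriv k \<Phi> z \<le> normal_deriv k w z"
      by (rule normal_deriv_boundary_touching[OF cw c\<Phi> 2 U zU]) (use le z in \<open>auto simp: K_def\<close>)
    moreover have "normal_deriv k \<Phi> z = 0"
      unfolding \<Phi>_def[abs_def] using normal_deriv_quadratic_ridge[OF e(1) 2, where c = c and d = d] e by simp
    moreover have "normal_deriv k w z = normal_deriv k \<omega> z - normal_deriv k \<omega> (reflect e z)"
      unfolding w_def[abs_def] using normal_deriv_lincomb[OF c\<omega> c\<rho> 2, of 1 "- 1"]
      by (simp add: normal_deriv_reflect[OF c\<omega> e 2])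
    moreover have "\<bar>\<omega> (reflect e z)\<bar> powr (p - 1) * \<omega> (reflect e z) < \<bar>\<omega> z\<bar> powr (p - 1) * \<omega> z"
      using wz p by (intro signed_power_strict_mono) (simp_all add: w_def)
    ultimately show False
      using solutionsD(4)[OF \<omega> 2] solutionsD(4)[OF \<omega> \<rho>z] by simp
  qed
qed

text \<open>In the interior the barrier has negative Laplacian and \<open>\<ell> \<le> 0\<close>
  only helps. On the equator its outward derivative is -1, so touching gives
  \<open>(M * c) powr (p - 1) * c \<le> 1\<close>, which a large \<open>c\<close> violates.\<close>

lemma solution_nonpos_of_ell_nonpos:
  fixes \<omega> :: "real^'n \<Rightarrow> real"
  assumes \<omega>: "\<omega> \<in> solutions k p" and p: "1 < p" and N: "2 \<le> CARD('n)"
    and l: "ell CARD('n) p \<le> 0" and z: "z \<in> closed_hemisphere k"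
  shows "\<omega> z \<le> 0"
proof (rule ccontr)
  let ?l = "ell CARD('n) p"
  assume "\<not> \<omega> z \<le> 0"
  then have wz: "0 < \<omega> z" by simp
  \<comment> \<open>Makes \<open>(\<omega> z / 2) powr (p - 1) * c\<close> exceed 1; the positive
    value at \<open>z\<close> will give the lower bound \<open>\<omega> z / 2\<close> for
    \<open>M * c\<close>.\<close>
  define c where "c = 1 + (\<omega> z / 2) powr (1 - p)"
  have c: "1 < c" using wz by (simp add: c_def)
  note c\<omega> = solutionsD(1)[OF \<omega>]
  define \<Phi> where "\<Phi> x = c + axis k 1 \<bullet> x - 1 / 4 * (axis k 1 \<bullet> x)\<^sup>2" for x :: "real^'n"
  have c\<Phi>: "classical_on_hemisphere k \<Phi>"
    unfolding \<Phi>_def[abs_def] by (rule classical_quadratic_ridge[OF axis_inner(2)])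
  have range: "0 \<le> x $ k" "x $ k \<le> 1" "(x $ k)\<^sup>2 \<le> x $ k" if "x \<in> closed_hemisphere k" for x
    using that abs_inner_le_1[OF axis_inner(2), of x k]
    by (auto simp: closed_hemisphere_iff axis_inner power2_eq_square mult_left_le)
  have pos: "0 < \<Phi> x" "\<Phi> x \<le> c + 1" if "x \<in> closed_hemisphere k" for x
    using range[OF that] c zero_le_power2[of "x $ k"] unfolding \<Phi>_def axis_inner by linarith+
  obtain x M where x: "x \<in> closed_hemisphere k" "\<omega> z / \<Phi> z \<le> M" "0 < M" "\<omega> x = M * \<Phi> x"
    and le: "\<And>y. y \<in> closed_hemisphere k \<Longrightarrow> \<omega> y \<le> M * \<Phi> y"
    by (rule max_ratio[OF compact_closed_hemisphere classical_continuous_on[OF c\<omega>]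
          classical_continuous_on[OF c\<Phi>] _ z wz]) (use pos in auto)
  from x(1) consider "x \<in> hemisphere k" | "x \<in> hemisphere_boundary k"
    by (auto simp: closed_hemisphere_def)
  then show False
  proof cases
    case 1
    show False
    proof (rule no_interior_touching[OF c\<omega> c\<Phi> 1 open_UNIV UNIV_I])
      show "\<omega> y \<le> M * \<Phi> y" if "y \<in> hemisphere k" for y
        using le[of y] that by (simp add: closed_hemisphere_def)
      show "0 \<le> laplace_beltrami \<omega> x + ?l * \<omega> x" using solutionsD(3)[OF \<omega> 1] by simp
      have "laplace_beltrami \<Phi> x = - (1 / 2) * (1 - (x $ k)\<^sup>2) - (real CARD('n) - 1) * (x $ k * (1 - x $ k / 2))"
        unfolding \<Phi>_def[abs_def]
        using laplace_beltrami_quadratic_ridge[OF axis_inner(2) 1, where c = c and d = "1/4"] by (simp add: axis_inner)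
      \<comment> \<open>The factor \<open>x $ k * (1 - x $ k / 2)\<close> is nonnegative, so
        \<open>N \<ge> 2\<close> allows replacing \<open>N - 1\<close> by 1.\<close>
      also have "\<dots> \<le> - (1 / 2) * (1 - (x $ k)\<^sup>2) - 1 * (x $ k * (1 - x $ k / 2))"
        using range[OF x(1)] N by (intro diff_mono order_refl mult_right_mono) auto
      also have "\<dots> = (x $ k)\<^sup>2 - x $ k - 1 / 2"
        by (simp add: power2_eq_square algebra_simps)
      also have "\<dots> < 0"
        using range(3)[OF x(1)] by linarith
      moreover have "?l * \<Phi> x \<le> 0"
        using pos(1)[OF x(1)] l by (simp add: mult_nonpos_nonneg)
      ultimately show "laplace_beltrami \<Phi> x + ?l * \<Phi> x < 0" by simp
    qed (rule x)+
  next
    case 2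
    then have xk: "x $ k = 0" by (simp add: hemisphere_boundary_def)
    have \<omega>x: "\<omega> x = M * c" using x(4) xk by (simp add: \<Phi>_def axis_inner)
    have "M * normal_deriv k \<Phi> x \<le> normal_deriv k \<omega> x"
      by (rule normal_deriv_boundary_touching[OF c\<omega> c\<Phi> 2 open_UNIV UNIV_I]) (use le x in auto)
    moreover have "normal_deriv k \<Phi> x = - 1"
      unfolding \<Phi>_def[abs_def] using normal_deriv_quadratic_ridge[OF axis_inner(2) 2, where c = c and d = "1/4"] xk
      by (simp add: axis_inner)
    ultimately have "M * ((M * c) powr (p - 1) * c) \<le> M * 1"
      using solutionsD(4)[OF \<omega> 2] \<omega>x x(3) c by (simp add: algebra_simps)
    then have "(M * c) powr (p - 1) * c \<le> 1" using x(3) by (simp only: mult_le_cancel_left_pos)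
    moreover have "\<omega> z / 2 \<le> M * c"
    proof -
      have "\<omega> z \<le> M * \<Phi> z" using x(2) pos[OF z] by (simp add: pos_divide_le_eq)
      \<comment> \<open>Here \<open>\<Phi> z \<le> c + 1 \<le> 2 * c\<close>, since
        \<open>c > 1\<close>.\<close>
      also have "\<dots> \<le> M * (2 * c)" using pos[OF z] c x(3) by (intro mult_left_mono) auto
      finally show ?thesis by simp
    qed
    then have "(\<omega> z / 2) powr (p - 1) * c \<le> (M * c) powr (p - 1) * c"
      using wz p c by (intro mult_right_mono powr_mono2) auto
    moreover have "(\<omega> z / 2) powr (p - 1) * c = (\<omega> z / 2) powr (p - 1) + 1"
      using wz by (simp add: c_def algebra_simps flip: powr_add)
    moreover have "0 < (\<omega> z / 2) powr (p - 1)" using wz by simp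
    ultimately show False by linarith
  qed
qed

lemma solutions_trivial_of_ell_nonpos:
  fixes k :: "'n::finite"
  assumes p: "1 < p" and N: "2 \<le> CARD('n)" and l: "ell CARD('n) p \<le> 0"
  shows "solutions k p = {\<lambda>x. 0}"
proof -
  have "\<omega> = (\<lambda>x. 0)" if \<omega>: "\<omega> \<in> solutions k p" for \<omega>
  proof (rule solutions_eqI[OF \<omega> zero_in_solutions])
    fix x assume "x \<in> closed_hemisphere k"
    then show "\<omega> x = 0"
      using solution_nonpos_of_ell_nonpos[OF \<omega> p N l, of x]
        solution_nonpos_of_ell_nonpos[OF solutions_uminus[OF \<omega>] p N l, of x] by simp
  qed
  then show ?thesis using zero_in_solutions by blast
qed

section \<open>Nonnegative solutions for large coefficients\<close>

text \<open>At a positive equatorial value the boundary condition makes the outward derivative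
  negative, so moving inward increases \<open>\<omega>\<close>.\<close>

lemma solution_pos_interior:
  fixes \<omega> :: "real^'n \<Rightarrow> real"
  assumes \<omega>: "\<omega> \<in> solutions k p" and z: "z \<in> closed_hemisphere k" and pos: "0 < \<omega> z"
  obtains x where "x \<in> hemisphere k" "0 < \<omega> x"
proof (cases "z \<in> hemisphere k")
  case False
  then have zb: "z \<in> hemisphere_boundary k" using z by (simp add: closed_hemisphere_def)
  have "normal_deriv k \<omega> z < 0"
    using solutionsD(4)[OF \<omega> zb] pos by simp
  from has_real_derivative_neg_dec_left[OF has_normal_deriv[OF solutionsD(1)[OF \<omega>] zb] this]
  obtain d where d: "0 < d" "\<And>h. 0 < h \<Longrightarrow> 0 - h \<in> {..0} \<Longrightarrow> h < d \<Longrightarrow>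
      \<omega> (sgn (z + 0 *\<^sub>R (- axis k 1))) < \<omega> (sgn (z + (0 - h) *\<^sub>R (- axis k 1)))"
    by blast
  define y where "y = z + (0 - d / 2) *\<^sub>R (- axis k 1)"
  have "0 < y $ k" using zb d(1) by (simp add: y_def hemisphere_boundary_def)
  then have "sgn y \<in> hemisphere k"
    by (auto simp: hemisphere_def vec_nth_sgn norm_sgn)
  moreover have "\<omega> z < \<omega> (sgn y)"
    using d(2)[of "d / 2"] d(1) zb unfolding y_def[symmetric]
    by (simp add: hemisphere_boundary_def sgn_eq_self)
  ultimately show ?thesis using that pos by force
qed (use that pos in blast)

text \<open>Strong maximum principle and Hopf lemma in one step: away from a ball around the point \<open>y\<close>
  where \<open>\<omega>\<close> is positive, the globally positive barrier \<open>exp (A * (y \<bullet> x))\<close> is strictly subharmonic,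
  and on the equator its inward normal derivative dominates its \<open>p\<close>-th power once it is
  multiplied by a small constant.\<close>

lemma nonneg_solution_pos:
  fixes \<omega> :: "real^'n \<Rightarrow> real"
  assumes \<omega>: "\<omega> \<in> solutions k p" and p: "1 < p" and N: "2 \<le> CARD('n)"
    and l: "0 \<le> ell CARD('n) p"
    and nonneg: "\<And>x. x \<in> closed_hemisphere k \<Longrightarrow> 0 \<le> \<omega> x"
    and y: "y \<in> hemisphere k" and \<omega>y: "0 < \<omega> y" and x: "x \<in> closed_hemisphere k"
  shows "0 < \<omega> x"
proof -
  let ?l = "ell CARD('n) p" and ?n = "real CARD('n)"
  note c\<omega> = solutionsD(1)[OF \<omega>]
  have yk: "0 < y $ k" and yy: "y \<bullet> y = 1" and yc: "y \<in> closed_hemisphere k"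
    using y by (auto simp: hemisphere_def norm_eq_1 closed_hemisphere_def)
  obtain d where d: "0 < d" "\<And>x. x \<in> closed_hemisphere k \<Longrightarrow> dist x y < d \<Longrightarrow> dist (\<omega> x) (\<omega> y) < \<omega> y / 2"
    using classical_continuous_on[OF c\<omega>] yc \<omega>y unfolding continuous_on_iff by (metis half_gt_zero)
  \<comment> \<open>Unit vectors satisfy
    \<open>(dist x y)\<^sup>2 = 2 - 2 * (y \<bullet> x)\<close>, so
    \<open>y \<bullet> x > 1 - r\<close> means distance below \<open>d\<close>.\<close>
  define r where "r = d\<^sup>2 / 2"
  have r: "0 < r" using d by (simp add: r_def)
  have near: "\<omega> y / 2 \<le> \<omega> x" if "x \<in> closed_hemisphere k" "1 - r < y \<bullet> x" for x
  proof -
    have "x \<bullet> x = 1" using that by (simp add: closed_hemisphere_iff norm_eq_1)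
    then have "(dist x y)\<^sup>2 = 2 - 2 * (y \<bullet> x)"
      using yy by (simp add: dist_norm power2_norm_eq_inner inner_diff_left inner_diff_right inner_commute)
    also have "\<dots> < d\<^sup>2" using that by (simp add: r_def)
    finally have "dist x y < d" using d(1) by (simp add: power_less_imp_less_base)
    then show ?thesis using d(2)[OF that(1)] by (auto simp: dist_real_def abs_if split: if_splits)
  qed
  \<comment> \<open>For \<open>0 < t \<le> 1 - r\<close> this gives
    \<open>(1 - t\<^sup>2) * A \<ge> r * A = N > (N - 1) * t\<close>, hence strict subharmonicity of
    the barrier.\<close>
  define A where "A = ?n / r"
  have A: "0 < A" "A * r = ?n" using r N by (auto simp: A_def)
  define \<Phi> where "\<Phi> x = exp (A * (y \<bullet> x))" for x
  have 1: "((\<lambda>t. exp (A * t)) has_real_derivative A * exp (A * t)) (at t)" for t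
    by (auto intro!: derivative_eq_intros)
  have 2: "((\<lambda>t. A * exp (A * t)) has_real_derivative A * A * exp (A * t)) (at t)" for t
    by (auto intro!: derivative_eq_intros)
  have 3: "continuous_on UNIV (\<lambda>t. A * A * exp (A * t))" by (intro continuous_intros)
  note ridge = open_UNIV UNIV_I 1 2 3
  have c\<Phi>: "classical_on_hemisphere k \<Phi>"
    unfolding \<Phi>_def[abs_def] by (rule classical_ridge[OF ridge])
  have sub: "0 < laplace_beltrami \<Phi> x" if x: "x \<in> hemisphere k" and far: "y \<bullet> x \<le> 1 - r" for x
  proof -
    let ?t = "y \<bullet> x"
    have t: "\<bar>?t\<bar> \<le> 1" using abs_inner_le_1[OF yy] x by (simp add: hemisphere_def)
    have "(?n - 1) * ?t < (1 - ?t\<^sup>2) * A"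
    proof (cases "0 < ?t")
      case True
      have "(?n - 1) * ?t \<le> (?n - 1) * 1" using t N by (intro mult_left_mono) auto
      also have "\<dots> < r * A" using A by (simp add: mult.commute)
      also have "\<dots> \<le> (1 - ?t) * A" using far A by (intro mult_right_mono) auto
      also have "\<dots> \<le> (1 - ?t\<^sup>2) * A"
        using t True A by (intro mult_right_mono) (auto simp: power2_eq_square mult_left_le)
      finally show ?thesis .
    next
      case False
      have "?t\<^sup>2 \<le> 1" using t by (simp add: abs_square_le_1)
      \<comment> \<open>At \<open>t = - 1\<close> the right side is 0, so for negative
        \<open>t\<close> strictness comes from the left side; at \<open>t = 0\<close> it comes from
        \<open>A > 0\<close>.\<close>
      show ?thesis
      proof (cases "?t = 0")
        case False
        then have "(?n - 1) * ?t < 0" using \<open>\<not> 0 < ?t\<close> N by (intro mult_pos_neg) auto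
        moreover have "0 \<le> (1 - ?t\<^sup>2) * A" using \<open>?t\<^sup>2 \<le> 1\<close> A by simp
        ultimately show ?thesis by linarith
      qed (use A in simp)
    qed
    then have "0 < A * exp (A * ?t) * ((1 - ?t\<^sup>2) * A - (?n - 1) * ?t)"
      using A by simp
    also have "\<dots> = laplace_beltrami \<Phi> x"
      unfolding \<Phi>_def[abs_def] using laplace_beltrami_ridge[OF ridge x, of y] yy
      by (simp add: algebra_simps)
    finally show ?thesis .
  qed
  \<comment> \<open>An upper bound for the scaled barrier: the first entry keeps it at most
    \<open>\<omega>\<close> near \<open>y\<close>, the second gives
    \<open>s powr (p - 1) \<le> A * y $ k\<close>, so that the boundary power does not exceed the
    inward derivative.\<close>
  define s where "s = min (\<omega> y / 2) ((A * y $ k) powr (1 / (p - 1)))"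
  have s: "0 < s" "s \<le> \<omega> y / 2" using \<omega>y A yk by (auto simp: s_def)
  have "s powr (p - 1) \<le> ((A * y $ k) powr (1 / (p - 1))) powr (p - 1)"
    using s p by (intro powr_mono2) (auto simp: s_def)
  also have "\<dots> = A * y $ k" using p A yk by (simp add: powr_powr)
  finally have sp: "s powr (p - 1) \<le> A * y $ k" .
  define t where "t = s / exp A"
  have t: "0 < t" using s by (simp add: t_def)
  have \<Phi>: "0 < \<Phi> x" for x by (simp add: \<Phi>_def)
  have t\<Phi>: "t * \<Phi> x \<le> s" if "x \<in> closed_hemisphere k" for x
  proof -
    have "y \<bullet> x \<le> 1" using abs_inner_le_1[OF yy, of x] that by (auto simp: closed_hemisphere_iff)
    then have "\<Phi> x \<le> exp A" using A by (simp add: \<Phi>_def mult_left_le)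
    then show ?thesis using s by (simp add: t_def field_simps)
  qed
  have "t * \<Phi> x \<le> \<omega> x"
  proof (rule ccontr)
    assume contra: "\<not> t * \<Phi> x \<le> \<omega> x"
    define w where "w x = t * \<Phi> x + (- 1) * \<omega> x" for x
    have cw: "classical_on_hemisphere k w"
      unfolding w_def[abs_def] by (rule classical_lincomb(1)[OF c\<Phi> c\<omega>])
    obtain z where z: "z \<in> closed_hemisphere k" and max: "\<And>y. y \<in> closed_hemisphere k \<Longrightarrow> w y \<le> w z"
      using continuous_attains_sup[OF compact_closed_hemisphere _ classical_continuous_on[OF cw]] x by blast
    have less: "\<omega> z < t * \<Phi> z"
      using max[OF x] contra by (simp add: w_def)
    have far: "y \<bullet> z \<le> 1 - r"
      using near[OF z] less t\<Phi>[OF z] s by linarith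
    from z consider "z \<in> hemisphere k" | "z \<in> hemisphere_boundary k"
      by (auto simp: closed_hemisphere_def)
    then show False
    proof cases
      case 1
      have "laplace_beltrami w z \<le> 0"
        by (rule laplace_beltrami_nonpos_at_local_max[OF cw 1 open_UNIV UNIV_I])
           (use max in \<open>auto simp: closed_hemisphere_def\<close>)
      moreover have "laplace_beltrami w z = t * laplace_beltrami \<Phi> z - laplace_beltrami \<omega> z"
        unfolding w_def[abs_def] using classical_lincomb(2)[OF c\<Phi> c\<omega> 1, of t "- 1"] by simp
      moreover have "0 < t * laplace_beltrami \<Phi> z" using t sub[OF 1 far] by simp
      moreover have "0 \<le> ?l * \<omega> z" using l nonneg[OF z] by simp
      ultimately show False using solutionsD(3)[OF \<omega> 1] by linarith
    next
      case 2
      have "0 \<le> normal_deriv k w z"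
        by (rule normal_deriv_nonneg_at_local_max[OF cw 2 open_UNIV UNIV_I]) (use max in auto)
      moreover have "normal_deriv k w z = t * normal_deriv k \<Phi> z - normal_deriv k \<omega> z"
        unfolding w_def[abs_def] using normal_deriv_lincomb[OF c\<Phi> c\<omega> 2, of t "- 1"] by simp
      moreover have "normal_deriv k \<Phi> z = - (A * \<Phi> z * y $ k)"
        unfolding \<Phi>_def[abs_def] using normal_deriv_ridge[OF ridge 2, of y] by simp
      moreover have "\<bar>\<omega> z\<bar> powr (p - 1) * \<omega> z < \<bar>t * \<Phi> z\<bar> powr (p - 1) * (t * \<Phi> z)"
        using less p by (rule signed_power_strict_mono)
      moreover have "\<bar>t * \<Phi> z\<bar> powr (p - 1) * (t * \<Phi> z) \<le> (A * y $ k) * (t * \<Phi> z)"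
      proof (rule mult_right_mono)
        have "\<bar>t * \<Phi> z\<bar> powr (p - 1) \<le> s powr (p - 1)"
          using t\<Phi>[OF z] t \<Phi>[of z] p by (intro powr_mono2) auto
        then show "\<bar>t * \<Phi> z\<bar> powr (p - 1) \<le> A * y $ k" using sp by simp
      qed (use t \<Phi>[of z] in simp)
      ultimately show False using solutionsD(4)[OF \<omega> 2] by (simp add: algebra_simps)
    qed
  qed
  moreover have "0 < t * \<Phi> x" using t \<Phi> by simp
  ultimately show ?thesis by linarith
qed

lemma axis_in_hemisphere: "axis k 1 \<in> hemisphere k"
  by (simp add: hemisphere_def norm_axis_1)

text \<open>The positive solution itself takes the place of the barrier, and
  \<open>c + x $ k\<close> is compared with it. As \<open>x $ k\<close> is an eigenfunction for
  \<open>N - 1\<close>, an interior touching forces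
  \<open>\<ell> * (c + t) \<le> (N - 1) * t\<close>, impossible for \<open>c > 0\<close>; on the
  equator it forces \<open>1 \<le> \<omega> z powr (p - 1) * c\<close>.\<close>

lemma nonneg_solution_zero_of_ell_large:
  fixes \<omega> :: "real^'n \<Rightarrow> real"
  assumes \<omega>: "\<omega> \<in> solutions k p" and p: "1 < p" and N: "2 \<le> CARD('n)"
    and l: "real CARD('n) - 1 \<le> ell CARD('n) p"
    and nonneg: "\<And>x. x \<in> closed_hemisphere k \<Longrightarrow> 0 \<le> \<omega> x" and x: "x \<in> closed_hemisphere k"
  shows "\<omega> x = 0"
proof (rule ccontr)
  let ?l = "ell CARD('n) p" and ?n = "real CARD('n)"
  assume "\<omega> x \<noteq> 0"
  then have "0 < \<omega> x" using nonneg[OF x] by simp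
  then obtain y where y: "y \<in> hemisphere k" "0 < \<omega> y"
    using solution_pos_interior[OF \<omega> x] by blast
  have l0: "0 \<le> ?l" using l N by simp
  have pos: "0 < \<omega> x" if "x \<in> closed_hemisphere k" for x
    by (rule nonneg_solution_pos[OF \<omega> p N l0 nonneg y that])
  note c\<omega> = solutionsD(1)[OF \<omega>]
  define q where "q = axis k (1::real)"
  have q: "q \<in> closed_hemisphere k"
    using axis_in_hemisphere[of k] by (simp add: q_def closed_hemisphere_def)
  \<comment> \<open>With \<open>c * \<omega> q \<le> 1\<close> at the pole \<open>q\<close>, the
    bound \<open>M \<ge> 1 / \<omega> q\<close> yields \<open>\<omega> z = c / M \<le> 1\<close> at
    an equatorial maximum, whence \<open>c \<ge> 1\<close>, contrary to
    \<open>c < 1\<close>.\<close>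
  define c where "c = min (1 / 2) (1 / \<omega> q)"
  have c: "0 < c" "c < 1" "c * \<omega> q \<le> 1" using pos[OF q] by (auto simp: c_def min_mult_distrib_right)
  define \<Phi> where "\<Phi> x = c + axis k 1 \<bullet> x - 0 * (axis k 1 \<bullet> x)\<^sup>2" for x :: "real^'n"
  have c\<Phi>: "classical_on_hemisphere k \<Phi>"
    unfolding \<Phi>_def[abs_def] by (rule classical_quadratic_ridge[OF axis_inner(2)])
  have \<Phi>q: "\<Phi> q = c + 1" by (simp add: \<Phi>_def q_def axis_inner)
  obtain z M where z: "z \<in> closed_hemisphere k" "\<Phi> q / \<omega> q \<le> M" "0 < M" "\<Phi> z = M * \<omega> z"
    and le: "\<And>y. y \<in> closed_hemisphere k \<Longrightarrow> \<Phi> y \<le> M * \<omega> y"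
    by (rule max_ratio[OF compact_closed_hemisphere classical_continuous_on[OF c\<Phi>]
          classical_continuous_on[OF c\<omega>] _ q]) (use pos \<Phi>q c in auto)
  from z(1) consider "z \<in> hemisphere k" | "z \<in> hemisphere_boundary k"
    by (auto simp: closed_hemisphere_def)
  then show False
  proof cases
    case 1
    have "laplace_beltrami (\<lambda>x. 1 * \<Phi> x + (- M) * \<omega> x) z \<le> 0"
      by (rule laplace_beltrami_nonpos_at_local_max[OF classical_lincomb(1)[OF c\<Phi> c\<omega>] 1 open_UNIV UNIV_I])
         (use le z in \<open>auto simp: closed_hemisphere_def\<close>)
    then have "laplace_beltrami \<Phi> z \<le> M * laplace_beltrami \<omega> z"
      using classical_lincomb(2)[OF c\<Phi> c\<omega> 1, of 1 "- M"] by simp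
    also have "laplace_beltrami \<omega> z = - (?l * \<omega> z)" using solutionsD(3)[OF \<omega> 1] by simp
    also have "M * (- (?l * \<omega> z)) = - (?l * (c + z $ k))"
      using z(4) by (simp add: \<Phi>_def axis_inner)
    finally have "?l * (c + z $ k) \<le> (?n - 1) * z $ k"
      unfolding \<Phi>_def[abs_def]
      using laplace_beltrami_quadratic_ridge[OF axis_inner(2) 1, where c = c and d = 0] by (simp add: axis_inner)
    moreover have "(?n - 1) * (c + z $ k) \<le> ?l * (c + z $ k)"
      using l c 1 by (intro mult_right_mono) (auto simp: hemisphere_def)
    moreover have "0 < (?n - 1) * c" using N c by simp
    ultimately show False by (simp add: algebra_simps)
  next
    case 2
    then have zk: "z $ k = 0" by (simp add: hemisphere_boundary_def)
    have Mw: "M * \<omega> z = c" using z(4) zk by (simp add: \<Phi>_def axis_inner)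
    have wz: "0 < \<omega> z" by (rule pos[OF z(1)])
    have "M * normal_deriv k \<omega> z \<le> normal_deriv k \<Phi> z"
      using normal_deriv_nonneg_at_local_max[OF classical_lincomb(1)[OF c\<Phi> c\<omega>] 2 open_UNIV UNIV_I, of 1 "- M"]
        normal_deriv_lincomb[OF c\<Phi> c\<omega> 2, of 1 "- M"] le z by auto
    moreover have "normal_deriv k \<Phi> z = - 1"
      unfolding \<Phi>_def[abs_def]
      using normal_deriv_quadratic_ridge[OF axis_inner(2) 2, where c = c and d = 0] by (simp add: axis_inner)
    ultimately have "1 \<le> M * (\<omega> z powr (p - 1) * \<omega> z)"
      using solutionsD(4)[OF \<omega> 2] wz by simp
    also have "\<dots> = \<omega> z powr (p - 1) * c" using Mw by (simp add: algebra_simps flip: Mw)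
    also have "\<dots> \<le> 1 * c"
    proof (rule mult_right_mono)
      have "1 / \<omega> q \<le> M"
        using z(2) \<Phi>q c pos[OF q] by (smt (verit) divide_right_mono)
      then have "\<omega> z \<le> c * \<omega> q"
        using Mw z(3) wz pos[OF q] by (smt (verit) mult_right_mono mult.commute mult.left_commute pos_divide_le_eq mult_le_cancel_left1)
      then have "\<omega> z \<le> 1" using c by simp
      then show "\<omega> z powr (p - 1) \<le> 1" using wz p by (simp add: powr_le1)
    qed (use c in simp)
    finally show False using c by simp
  qed
qed

section \<open>The zonal solution and the classification\<close>

text \<open>The coefficients \<open>(a)_n (b)_n / ((c)_n n!)\<close> of the Gauss series 2F1(a, b;
  c; z), given by their ratio, which is what the convergence test, the differential equation and the
  sign argument use.\<close>

primrec hypergeo_coeff :: "real \<Rightarrow> real \<Rightarrow> real \<Rightarrow> nat \<Rightarrow> real" where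
  "hypergeo_coeff a b c 0 = 1"
| "hypergeo_coeff a b c (Suc n) =
     (real n + a) * (real n + b) / ((real n + 1) * (real n + c)) * hypergeo_coeff a b c n"

lemma summable_hypergeo:
  fixes x :: real
  assumes "\<bar>x\<bar> < 1"
  shows "summable (\<lambda>n. hypergeo_coeff a b c n * x ^ n)"
proof -
  let ?q = "\<lambda>n. (real n + a) * (real n + b) / ((real n + 1) * (real n + c))"
  have "(?q \<longlongrightarrow> 1) at_top" by real_asymp
  then have "((\<lambda>n. \<bar>?q n * x\<bar>) \<longlongrightarrow> \<bar>1 * x\<bar>) at_top" by (intro tendsto_intros)
  \<comment> \<open>The midpoint of \<open>\<bar>x\<bar>\<close> and 1 serves as the constant of the
    ratio test.\<close>
  then have "eventually (\<lambda>n. \<bar>?q n * x\<bar> < (1 + \<bar>x\<bar>) / 2) at_top"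
    using assms by (intro order_tendstoD) auto
  then obtain m where m: "\<And>n. m \<le> n \<Longrightarrow> \<bar>?q n * x\<bar> < (1 + \<bar>x\<bar>) / 2"
    unfolding eventually_at_top_linorder by blast
  show ?thesis
  proof (rule summable_ratio_test)
    show "(1 + \<bar>x\<bar>) / 2 < 1" using assms by simp
    fix n assume n: "m \<le> n"
    have "hypergeo_coeff a b c (Suc n) * x ^ Suc n = (?q n * x) * (hypergeo_coeff a b c n * x ^ n)"
      by simp
    then show "norm (hypergeo_coeff a b c (Suc n) * x ^ Suc n)
        \<le> (1 + \<bar>x\<bar>) / 2 * norm (hypergeo_coeff a b c n * x ^ n)"
      using m[OF n] by (simp only: real_norm_def abs_mult[of "?q n * x"]) (intro mult_right_mono, auto)
  qed
qed

text \<open>\<open>diffs\<close> is termwise differentiation; multiplication by \<open>z\<close>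
  undoes its index shift, and the new term at \<open>n = 0\<close> has factor 0.\<close>

lemma sums_diffs_mult:
  fixes z :: "'a::{real_normed_field,banach}"
  assumes "(\<lambda>n. diffs u n * z ^ n) sums s"
  shows "(\<lambda>n. of_nat n * u n * z ^ n) sums (z * s)"
proof -
  have "(\<lambda>n. of_nat (Suc n) * u (Suc n) * z ^ Suc n) sums (z * s)"
    using sums_mult[OF assms, of z] by (simp add: diffs_def mult_ac)
  then show ?thesis using sums_Suc[of "\<lambda>n. of_nat n * u n * z ^ n"] by simp
qed

lemma hypergeo_ode:
  fixes a b c z :: real
  assumes F0: "(\<lambda>n. hypergeo_coeff a b c n * z ^ n) sums F0"
    and F1: "(\<lambda>n. diffs (hypergeo_coeff a b c) n * z ^ n) sums F1"
    and F2: "(\<lambda>n. diffs (diffs (hypergeo_coeff a b c)) n * z ^ n) sums F2"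
    and c: "0 < c"
  shows "z * (1 - z) * F2 + (c - (a + b + 1) * z) * F1 - a * b * F0 = 0"
proof -
  let ?h = "hypergeo_coeff a b c"
  have zF1: "(\<lambda>n. real n * ?h n * z ^ n) sums (z * F1)"
    using sums_diffs_mult[OF F1] by simp
  have zF2: "(\<lambda>n. real n * diffs ?h n * z ^ n) sums (z * F2)"
    using sums_diffs_mult[OF F2] by simp
  \<comment> \<open>The shift applied to \<open>(n - 1) * h n\<close>, whose \<open>diffs\<close>
    series sums to \<open>z * F2\<close>, produces the weights \<open>n * (n - 1)\<close> of
    \<open>z\<^sup>2 * F2\<close>.\<close>
  have "diffs (\<lambda>n. (real n - 1) * ?h n) n = real n * diffs ?h n" for n
    by (simp add: diffs_def)
  then have zzF2: "(\<lambda>n. real n * ((real n - 1) * ?h n) * z ^ n) sums (z * (z * F2))"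
    using zF2 sums_diffs_mult[of "\<lambda>n. (real n - 1) * ?h n" z "z * F2"] by simp
  have "(\<lambda>n. real n * diffs ?h n * z ^ n - real n * ((real n - 1) * ?h n) * z ^ n
      + (c * (diffs ?h n * z ^ n) - (a + b + 1) * (real n * ?h n * z ^ n)) - a * b * (?h n * z ^ n))
      sums (z * F2 - z * (z * F2) + (c * F1 - (a + b + 1) * (z * F1)) - a * b * F0)"
    by (intro sums_diff sums_add sums_mult F0 F1 zF1 zF2 zzF2)
  moreover have "real n * diffs ?h n * z ^ n - real n * ((real n - 1) * ?h n) * z ^ n
      + (c * (diffs ?h n * z ^ n) - (a + b + 1) * (real n * ?h n * z ^ n)) - a * b * (?h n * z ^ n) = 0" for n
  proof -
    \<comment> \<open>The recursion cleared of its denominators, where \<open>c > 0\<close> keeps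
      \<open>n + c\<close> nonzero. The weights of \<open>h n\<close> in the equation add up to
      \<open>n * (n - 1) + (a + b + 1) * n + a * b = (n + a) * (n + b)\<close>.\<close>
    have "(real n + c) * diffs ?h n = (real n + a) * (real n + b) * ?h n"
      using c by (simp add: diffs_def add.commute)
    then have "((real n + c) * diffs ?h n - (real n + a) * (real n + b) * ?h n) * z ^ n = 0" by simp
    then show ?thesis by (simp add: algebra_simps)
  qed
  ultimately have "z * F2 - z * (z * F2) + (c * F1 - (a + b + 1) * (z * F1)) - a * b * F0 = 0"
    using sums_unique2 sums_zero by (metis (no_types, lifting) sums_cong)
  then show ?thesis by (simp add: algebra_simps)
qed

text \<open>Only the first ratio contains the negative factor \<open>b\<close>; from then on
  \<open>n + b > 0\<close> because \<open>b > -1\<close>.\<close>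

lemma hypergeo_coeff_neg:
  assumes "0 < a" "-1 < b" "b < 0" "0 < c"
  shows "hypergeo_coeff a b c (Suc n) < 0"
proof (induction n)
  case 0
  then show ?case using assms by (simp add: divide_neg_pos mult_pos_neg)
next
  case (Suc n)
  have "0 < (real (Suc n) + a) * (real (Suc n) + b) / ((real (Suc n) + 1) * (real (Suc n) + c))"
    using assms by (intro divide_pos_pos mult_pos_pos) auto
  then show ?case using Suc by (simp only: hypergeo_coeff.simps(2)[of a b c "Suc n"] mult_pos_neg)
qed

text \<open>The substitution \<open>z = (1 - s) / 2\<close> turns the zonal equation into the hypergeometric equation
  with parameters \<open>\<alpha>\<close>, \<open>n - 2 - \<alpha>\<close> and \<open>(n - 1) / 2\<close>.\<close>

lemma zonal_profile:
  fixes n \<alpha> :: real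
  assumes n: "2 \<le> n" and \<alpha>: "0 < \<alpha>" "n - 2 < \<alpha>" "\<alpha> < n - 1"
  obtains \<psi> \<psi>1 \<psi>2 :: "real \<Rightarrow> real" where
    "\<And>s. s \<in> {-1<..<3} \<Longrightarrow> (\<psi> has_real_derivative \<psi>1 s) (at s)"
    "\<And>s. s \<in> {-1<..<3} \<Longrightarrow> (\<psi>1 has_real_derivative \<psi>2 s) (at s)"
    "continuous_on {-1<..<3} \<psi>2"
    "\<And>s. s \<in> {-1<..<3} \<Longrightarrow> (1 - s\<^sup>2) * \<psi>2 s - (n - 1) * s * \<psi>1 s + \<alpha> * (\<alpha> + 2 - n) * \<psi> s = 0"
    "\<psi> 1 = 1"
    "\<And>s. 0 \<le> s \<Longrightarrow> s \<le> 1 \<Longrightarrow> 0 < \<psi>1 s"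
proof -
  \<comment> \<open>The bounds on \<open>\<alpha>\<close> place \<open>b\<close> between -1 and 0;
    also \<open>\<alpha> + b + 1 = 2 * c\<close>, and \<open>\<alpha> * b\<close> is minus the
    coefficient of the zonal equation.\<close>
  define b where "b = n - 2 - \<alpha>"
  define c where "c = (n - 1) / 2"
  let ?h = "hypergeo_coeff \<alpha> b c"
  have c: "0 < c" using n by (simp add: c_def)
  define F where "F z = (\<Sum>n. ?h n * z ^ n)" for z :: real
  define F1 where "F1 z = (\<Sum>n. diffs ?h n * z ^ n)" for z :: real
  define F2 where "F2 z = (\<Sum>n. diffs (diffs ?h) n * z ^ n)" for z :: real
  have s0: "summable (\<lambda>n. ?h n * z ^ n)" if "norm z < 1" for z :: real
    using summable_hypergeo that by simp
  have s1: "summable (\<lambda>n. diffs ?h n * z ^ n)" if "norm z < 1" for z :: real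
    using termdiff_converges[OF that s0] .
  have s2: "summable (\<lambda>n. diffs (diffs ?h) n * z ^ n)" if "norm z < 1" for z :: real
    using termdiff_converges[OF that s1] .
  have dF: "(F has_real_derivative F1 z) (at z)" if "norm z < 1" for z
    unfolding F_def[abs_def] F1_def by (rule termdiffs_strong'[OF s0 that])
  have dF1: "(F1 has_real_derivative F2 z) (at z)" if "norm z < 1" for z
    unfolding F1_def[abs_def] F2_def by (rule termdiffs_strong'[OF s1 that])
  have cF2: "isCont F2 z" if "norm z < 1" for z
    unfolding F2_def[abs_def] by (rule DERIV_isCont[OF termdiffs_strong'[OF s2 that]])
  \<comment> \<open>All coefficients beyond the constant one are negative, so \<open>F\<close>
    decreases on \<open>[0, 1)\<close>, which makes \<open>\<psi>\<close> increase in
    \<open>s\<close>.\<close>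
  have F1neg: "F1 z < 0" if "0 \<le> z" "z < 1" for z
  proof -
    have neg: "diffs ?h n < 0" for n
      using hypergeo_coeff_neg[of \<alpha> b c n] \<alpha> c
      by (simp add: diffs_def b_def mult_pos_neg del: hypergeo_coeff.simps)
    have "0 < (\<Sum>n. - (diffs ?h n * z ^ n))"
    proof (rule suminf_pos2[of _ 0])
      show "summable (\<lambda>n. - (diffs ?h n * z ^ n))" using s1[of z] that by (intro summable_minus) auto
      show "0 \<le> - (diffs ?h n * z ^ n)" for n
        using neg[of n] that by (simp add: mult_nonpos_nonneg)
      show "0 < - (diffs ?h 0 * z ^ 0)" using neg[of 0] by simp
    qed
    also have "\<dots> = - F1 z" unfolding F1_def using s1[of z] that by (intro suminf_minus) auto
    finally show ?thesis by simp
  qed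
  define \<psi> where "\<psi> s = F ((1 - s) / 2)" for s
  define \<psi>1 where "\<psi>1 s = - F1 ((1 - s) / 2) / 2" for s
  define \<psi>2 where "\<psi>2 s = F2 ((1 - s) / 2) / 4" for s
  \<comment> \<open>The interval \<open>{-1<..<3}\<close> corresponds to the disc of convergence; it
    is a neighbourhood of \<open>[0, 1]\<close>, and the pole \<open>s = 1\<close> is the centre of
    the series.\<close>
  have z: "norm ((1 - s) / 2) < 1" if "s \<in> {-1<..<3}" for s :: real
    using that by (auto simp: abs_if)
  have dz: "((\<lambda>s. (1 - s) / 2) has_real_derivative - (1 / 2)) (at s)" for s :: real
    by (auto intro!: derivative_eq_intros)
  show thesis
  proof
    show "(\<psi> has_real_derivative \<psi>1 s) (at s)" if "s \<in> {-1<..<3}" for s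
      unfolding \<psi>_def[abs_def] \<psi>1_def using DERIV_chain2[OF dF[OF z[OF that]] dz] by simp
    show "(\<psi>1 has_real_derivative \<psi>2 s) (at s)" if "s \<in> {-1<..<3}" for s
      unfolding \<psi>1_def[abs_def] \<psi>2_def
      by (rule DERIV_cong[OF DERIV_cdivide[OF DERIV_minus[OF DERIV_chain2[OF dF1[OF z[OF that]] dz]]]]) simp
    have "isCont \<psi>2 s" if "s \<in> {-1<..<3}" for s
      unfolding \<psi>2_def[abs_def]
      using isCont_o2[OF DERIV_isCont[OF dz] cF2[OF z[OF that]]] by (intro continuous_intros) auto
    then show "continuous_on {-1<..<3} \<psi>2" by (blast intro: continuous_at_imp_continuous_on)
    show "(1 - s\<^sup>2) * \<psi>2 s - (n - 1) * s * \<psi>1 s + \<alpha> * (\<alpha> + 2 - n) * \<psi> s = 0" if "s \<in> {-1<..<3}" for s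
    proof -
      define y where "y = (1 - s) / 2"
      have y: "norm y < 1" using z[OF that] by (simp add: y_def)
      have s: "s = 1 - 2 * y" by (simp add: y_def field_simps)
      have "y * (1 - y) * F2 y + (c - (\<alpha> + b + 1) * y) * F1 y - \<alpha> * b * F y = 0"
        unfolding F_def F1_def F2_def
        by (rule hypergeo_ode[OF summable_sums[OF s0[OF y]] summable_sums[OF s1[OF y]] summable_sums[OF s2[OF y]] c])
      then show ?thesis
        unfolding \<psi>_def \<psi>1_def \<psi>2_def y_def[symmetric] unfolding s b_def c_def
        by (simp add: field_simps power2_eq_square)
    qed
    show "\<psi> 1 = 1" using powser_zero[of ?h] by (simp add: \<psi>_def F_def)
    show "0 < \<psi>1 s" if "0 \<le> s" "s \<le> 1" for s
      using F1neg[of "(1 - s) / 2"] that by (simp add: \<psi>1_def)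
  qed
qed

section \<open>Classification in the intermediate range\<close>

lemma exists_boundary_point:
  assumes "2 \<le> CARD('n::finite)"
  obtains x where "x \<in> hemisphere_boundary (k::'n)"
proof -
  have "UNIV \<noteq> {k}"
  proof
    assume "UNIV = {k}"
    then have "CARD('n) = card {k}" by simp
    then show False using assms by simp
  qed
  then obtain j where "j \<noteq> k" by blast
  then have "axis j (1::real) $ k = 0" by (simp add: axis_def)
  then have "axis j 1 \<in> hemisphere_boundary k"
    by (simp add: hemisphere_boundary_def norm_axis_1)
  then show ?thesis using that by blast
qed

text \<open>A solution is constant on the equator because it depends on the height only, so some
  \<open>c * \<Psi>\<close> has the same equatorial values. Dirichlet comparison makes the two
  equal, and the boundary condition leaves an algebraic equation for \<open>c\<close>.\<close>

lemma supercritical_classification: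
  fixes k :: "'n::finite"
  assumes N: "2 \<le> CARD('n)" and p: "1 < p"
    and \<alpha>: "real CARD('n) - 2 < 1 / (p - 1)" "1 / (p - 1) < real CARD('n) - 1"
  obtains \<omega>s where "positive_solution k p \<omega>s" "solutions k p = {\<omega>s, \<lambda>x. - \<omega>s x, \<lambda>x. 0}"
proof -
  let ?l = "ell CARD('n) p" and ?n = "real CARD('n)" and ?\<alpha> = "1 / (p - 1)"
  have \<alpha>0: "0 < ?\<alpha>" using p by simp
  have ell: "?l = ?\<alpha> * (?\<alpha> + 2 - ?n)" by (simp add: ell_def)
  have l: "0 < ?l" "?l < ?n - 1"
  proof -
    show "0 < ?l" unfolding ell using \<alpha>0 \<alpha> by (intro mult_pos_pos) auto
    have "?l \<le> ?\<alpha> * 1" unfolding ell using \<alpha>0 \<alpha> by (intro mult_left_mono) auto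
    then show "?l < ?n - 1" using \<alpha> by simp
  qed
  obtain \<psi> \<psi>1 \<psi>2 :: "real \<Rightarrow> real" where
    d1: "\<And>s. s \<in> {-1<..<3} \<Longrightarrow> (\<psi> has_real_derivative \<psi>1 s) (at s)"
    and d2: "\<And>s. s \<in> {-1<..<3} \<Longrightarrow> (\<psi>1 has_real_derivative \<psi>2 s) (at s)"
    and c2: "continuous_on {-1<..<3} \<psi>2"
    and ode: "\<And>s. s \<in> {-1<..<3} \<Longrightarrow> (1 - s\<^sup>2) * \<psi>2 s - (?n - 1) * s * \<psi>1 s + ?\<alpha> * (?\<alpha> + 2 - ?n) * \<psi> s = 0"
    and \<psi>1_1: "\<psi> 1 = 1"
    and mono: "\<And>s. 0 \<le> s \<Longrightarrow> s \<le> 1 \<Longrightarrow> 0 < \<psi>1 s"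
    using zonal_profile[of ?n ?\<alpha>] N \<alpha> \<alpha>0 by auto
  define \<Psi> where "\<Psi> x = \<psi> (axis k 1 \<bullet> x)" for x :: "real^'n"
  have range: "0 \<le> x $ k" "x $ k \<le> 1" if "x \<in> closed_hemisphere k" for x
    using that abs_inner_le_1[OF axis_inner(2), of x k] by (auto simp: closed_hemisphere_iff axis_inner)
  have I: "axis k 1 \<bullet> x \<in> {-1<..<3}" if "x \<in> closed_hemisphere k" for x
    using range[OF that] by (simp add: axis_inner)
  note ridge = open_greaterThanLessThan I d1 d2 c2
  have c\<Psi>: "classical_on_hemisphere k \<Psi>"
    unfolding \<Psi>_def[abs_def] by (rule classical_ridge[OF ridge])
  have LB: "laplace_beltrami \<Psi> x + ?l * \<Psi> x = 0" if "x \<in> hemisphere k" for x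
    using laplace_beltrami_ridge[OF ridge that] ode[OF I, of x] that
    unfolding ell by (simp add: \<Psi>_def[abs_def] axis_inner closed_hemisphere_def)
  have nd: "normal_deriv k \<Psi> x = - \<psi>1 0" if "x \<in> hemisphere_boundary k" for x
    using normal_deriv_ridge[OF ridge that] that
    by (simp add: \<Psi>_def[abs_def] axis_inner hemisphere_boundary_def)
  have bd: "\<Psi> x = \<psi> 0" if "x \<in> hemisphere_boundary k" for x
    using that by (simp add: \<Psi>_def axis_inner hemisphere_boundary_def)
  \<comment> \<open>Otherwise comparison would make \<open>\<Psi>\<close> nonpositive at the pole,
    where it is 1.\<close>
  have \<psi>0: "0 < \<psi> 0"
  proof (rule ccontr)
    assume "\<not> 0 < \<psi> 0"
    then have nonpos: "\<Psi> x \<le> 0" if "x \<in> hemisphere_boundary k" for x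
      using bd[OF that] by simp
    have "\<Psi> (axis k 1) \<le> 0"
      by (rule dirichlet_comparison[OF c\<Psi> l LB nonpos])
         (use axis_in_hemisphere[of k] in \<open>auto simp: closed_hemisphere_def\<close>)
    then show False by (simp add: \<Psi>_def axis_inner \<psi>1_1)
  qed
  have \<Psi>pos: "0 < \<Psi> x" if "x \<in> closed_hemisphere k" for x
  proof -
    have "\<psi> 0 \<le> \<psi> (x $ k)"
    proof (rule DERIV_nonneg_imp_nondecreasing[of 0 "x $ k" \<psi>])
      fix s assume "0 \<le> s" "s \<le> x $ k"
      then show "\<exists>y. (\<psi> has_real_derivative y) (at s) \<and> 0 \<le> y"
        using d1[of s] mono[of s] range[OF that] by (intro exI[of _ "\<psi>1 s"]) auto
    qed (rule range[OF that])
    then show ?thesis using \<psi>0 by (simp add: \<Psi>_def axis_inner)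
  qed
  obtain b where b: "b \<in> hemisphere_boundary k" using exists_boundary_point[OF N] by blast
  \<comment> \<open>For \<open>c \<noteq> 0\<close> the boundary condition for
    \<open>c * \<Psi>\<close> becomes \<open>\<bar>c\<bar> powr (p - 1) = \<kappa>\<close>.\<close>
  define \<kappa> where "\<kappa> = \<psi>1 0 / \<psi> 0 powr p"
  have \<kappa>: "0 < \<kappa>" using mono[of 0] \<psi>0 by (simp add: \<kappa>_def)
  define c0 where "c0 = \<kappa> powr (1 / (p - 1))"
  have c0: "0 < c0" "c0 powr (p - 1) = \<kappa>" using \<kappa> p by (auto simp: c0_def powr_powr)
  have power: "\<bar>c * \<psi> 0\<bar> powr (p - 1) * (c * \<psi> 0) = \<bar>c\<bar> powr (p - 1) * c * \<psi> 0 powr p" for c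
  proof -
    have "\<psi> 0 powr p = \<psi> 0 powr (p - 1) * \<psi> 0"
      using \<psi>0 powr_add[of "\<psi> 0" "p - 1" 1] by simp
    then show ?thesis using \<psi>0 by (simp add: abs_mult powr_mult)
  qed
  \<comment> \<open>The summand with coefficient 0 presents the multiple as a linear combination of
    two functions, for which regularity and both operators are already known.\<close>
  define \<omega>s where "\<omega>s x = (if x \<in> closed_hemisphere k then c0 * \<Psi> x + 0 * \<Psi> x else 0)" for x
  have eq: "\<omega>s x = c0 * \<Psi> x + 0 * \<Psi> x" if "x \<in> closed_hemisphere k" for x
    using that by (simp add: \<omega>s_def)
  have c\<omega>: "classical_on_hemisphere k (\<lambda>x. c0 * \<Psi> x + 0 * \<Psi> x)"
    by (rule classical_lincomb(1)[OF c\<Psi> c\<Psi>])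
  have \<omega>s: "\<omega>s \<in> solutions k p"
    unfolding solutions_def
  proof (intro CollectI conjI ballI allI impI)
    show "classical_on_hemisphere k \<omega>s" by (rule classical_cong[OF c\<omega> eq])
    show "laplace_beltrami \<omega>s x + ?l * \<omega>s x = 0" if x: "x \<in> hemisphere k" for x
    proof -
      have "x \<in> closed_hemisphere k" using x by (simp add: closed_hemisphere_def)
      then have "laplace_beltrami \<omega>s x + ?l * \<omega>s x = c0 * (laplace_beltrami \<Psi> x + ?l * \<Psi> x)"
        using laplace_beltrami_cong[OF c\<omega> eq x] classical_lincomb(2)[OF c\<Psi> c\<Psi> x, of c0 0]
        by (simp add: eq algebra_simps)
      then show ?thesis using LB[OF x] by simp
    qed
    show "normal_deriv k \<omega>s x + \<bar>\<omega>s x\<bar> powr (p - 1) * \<omega>s x = 0" if x: "x \<in> hemisphere_boundary k" for x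
    proof -
      have "x \<in> closed_hemisphere k" using x by (simp add: closed_hemisphere_def)
      then have "\<omega>s x = c0 * \<psi> 0" using bd[OF x] by (simp add: eq)
      moreover have "normal_deriv k \<omega>s x = - (c0 * \<psi>1 0)"
        using normal_deriv_cong[OF c\<omega> eq x] normal_deriv_lincomb[OF c\<Psi> c\<Psi> x, of c0 0] nd[OF x] by simp
      moreover have "\<kappa> * \<psi> 0 powr p = \<psi>1 0" using \<psi>0 by (simp add: \<kappa>_def)
      ultimately show ?thesis using power[of c0] c0 by (simp add: algebra_simps)
    qed
  qed (simp add: \<omega>s_def)
  have only: "\<omega> \<in> {\<omega>s, \<lambda>x. - \<omega>s x, \<lambda>x. 0}" if \<omega>: "\<omega> \<in> solutions k p" for \<omega>
  proof -
    note cl = solutionsD(1)[OF \<omega>]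
    define c where "c = \<omega> b / \<psi> 0"
    have bC: "b \<in> closed_hemisphere k" using b by (simp add: closed_hemisphere_def)
    have const: "\<omega> x = c * \<psi> 0" if x: "x \<in> hemisphere_boundary k" for x
    proof -
      have "x \<in> closed_hemisphere k" "x $ k = b $ k"
        using x b by (simp_all add: closed_hemisphere_def hemisphere_boundary_def)
      then have "\<omega> x = \<omega> b"
        using solution_le_on_latitude[OF \<omega> p l _ bC] solution_le_on_latitude[OF \<omega> p l bC]
        by (metis order_antisym)
      then show ?thesis using \<psi>0 by (simp add: c_def)
    qed
    have le: "a1 * \<omega> x + a2 * \<Psi> x \<le> 0" if "x \<in> closed_hemisphere k" "a2 = - a1 * c" for x a1 a2
    proof (rule dirichlet_comparison[OF classical_lincomb(1)[OF cl c\<Psi>] l _ _ that(1)])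
      fix y
      show "laplace_beltrami (\<lambda>x. a1 * \<omega> x + a2 * \<Psi> x) y + ?l * (a1 * \<omega> y + a2 * \<Psi> y) = 0"
        if y: "y \<in> hemisphere k"
      proof -
        have "a1 * (laplace_beltrami \<omega> y + ?l * \<omega> y) + a2 * (laplace_beltrami \<Psi> y + ?l * \<Psi> y) = 0"
          using solutionsD(3)[OF \<omega> y] LB[OF y] by simp
        then show ?thesis
          using classical_lincomb(2)[OF cl c\<Psi> y, of a1 a2] by (simp add: algebra_simps)
      qed
      show "a1 * \<omega> y + a2 * \<Psi> y \<le> 0" if "y \<in> hemisphere_boundary k"
        using const[OF that] bd[OF that] \<open>a2 = - a1 * c\<close> by simp
    qed
    \<comment> \<open>Dirichlet comparison for \<open>\<omega> - c * \<Psi>\<close> and for its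
      negative, both zero on the equator.\<close>
    have \<omega>c: "\<omega> x = c * \<Psi> x + 0 * \<Psi> x" if "x \<in> closed_hemisphere k" for x
      using le[OF that, of "- c" 1] le[OF that, of c "- 1"] by simp
    have "normal_deriv k \<omega> b = - (c * \<psi>1 0)"
      using normal_deriv_cong[OF classical_lincomb(1)[OF c\<Psi> c\<Psi>, of c 0] \<omega>c b]
        normal_deriv_lincomb[OF c\<Psi> c\<Psi> b, of c 0] nd[OF b] by simp
    then have "c * \<psi>1 0 = \<bar>c\<bar> powr (p - 1) * c * \<psi> 0 powr p"
      using solutionsD(4)[OF \<omega> b] unfolding const[OF b] power by linarith
    then have "c = 0 \<or> \<bar>c\<bar> powr (p - 1) = \<kappa>"
      using \<psi>0 by (auto simp: \<kappa>_def eq_divide_eq)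
    then consider "c = 0" | "\<bar>c\<bar> = c0"
    proof
      assume "\<bar>c\<bar> powr (p - 1) = \<kappa>"
      then have "c0 = (\<bar>c\<bar> powr (p - 1)) powr (1 / (p - 1))" by (simp add: c0_def)
      then have "\<bar>c\<bar> = c0" using p by (simp add: powr_powr)
      then show ?thesis using that by blast
    qed (use that in blast)
    then show ?thesis
    proof cases
      case 1
      have "\<omega> = (\<lambda>x. 0)"
        by (rule solutions_eqI[OF \<omega> zero_in_solutions]) (simp add: \<omega>c 1)
      then show ?thesis by simp
    next
      case 2
      then consider "c = c0" | "c = - c0" by linarith
      then show ?thesis
      proof cases
        case 1
        have "\<omega> = \<omega>s" by (rule solutions_eqI[OF \<omega> \<omega>s]) (simp add: \<omega>c eq 1)
        then show ?thesis by simp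
      next
        case 2
        have "\<omega> = (\<lambda>x. - \<omega>s x)"
          by (rule solutions_eqI[OF \<omega> solutions_uminus[OF \<omega>s]]) (simp add: \<omega>c eq 2)
        then show ?thesis by simp
      qed
    qed
  qed
  show ?thesis
  proof
    show "positive_solution k p \<omega>s"
      using \<omega>s c0 \<Psi>pos by (simp add: positive_solution_def eq)
    show "solutions k p = {\<omega>s, \<lambda>x. - \<omega>s x, \<lambda>x. 0}"
      using only \<omega>s solutions_uminus[OF \<omega>s] zero_in_solutions by blast
  qed
qed

section \<open>The three ranges of the exponent\<close>

theorem theoremA:
  fixes k :: "'n::finite" and p :: real
  assumes "CARD('n) \<ge> 2" and "p > 1"
  shows "(upper_exponent CARD('n) \<le> ereal p \<longrightarrow> solutions k p = {\<lambda>x. 0}) \<and>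
    (p \<le> real CARD('n) / (real CARD('n) - 1) \<longrightarrow> nonneg_solutions k p = {\<lambda>x. 0}) \<and>
    (real CARD('n) / (real CARD('n) - 1) < p \<and> ereal p < upper_exponent CARD('n) \<longrightarrow>
      (\<exists>\<omega>s. positive_solution k p \<omega>s \<and>
            (\<forall>\<omega>. positive_solution k p \<omega> \<longrightarrow> \<omega> = \<omega>s) \<and>
            solutions k p = {\<omega>s, \<lambda>x. - \<omega>s x, \<lambda>x. 0}))"
proof (intro conjI impI)
  let ?n = "real CARD('n)" and ?\<alpha> = "1 / (p - 1)"
  have n: "2 \<le> ?n" using assms(1) by simp
  have \<alpha>: "0 < ?\<alpha>" using assms(2) by simp
  have ell: "ell CARD('n) p = ?\<alpha> * (?\<alpha> + 2 - ?n)" by (simp add: ell_def)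
  show "solutions k p = {\<lambda>x. 0}" if "upper_exponent CARD('n) \<le> ereal p"
  proof (rule solutions_trivial_of_ell_nonpos[OF assms(2,1)])
    \<comment> \<open>For \<open>N = 2\<close> the upper exponent is infinite and cannot be at most
      \<open>p\<close>.\<close>
    have "CARD('n) \<noteq> 2" and *: "(?n - 1) / (?n - 2) \<le> p"
      using that by (auto simp: upper_exponent_def split: if_splits)
    then have "2 < ?n" using assms(1) by simp
    then have "?\<alpha> \<le> ?n - 2" using * assms(2) by (simp add: field_simps)
    then show "ell CARD('n) p \<le> 0" unfolding ell using \<alpha> by (intro mult_nonneg_nonpos) auto
  qed
  show "nonneg_solutions k p = {\<lambda>x. 0}" if "p \<le> ?n / (?n - 1)"
  proof -
    \<comment> \<open>Once \<open>?\<alpha>\<close> reaches \<open>?n - 1\<close>, the second factor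
      of the coefficient is at least 1 and the product is at least \<open>?n - 1\<close>.\<close>
    have "?n - 1 \<le> ?\<alpha>" using that n assms(2) by (simp add: field_simps)
    then have "(?n - 1) * 1 \<le> ?\<alpha> * (?\<alpha> + 2 - ?n)" using n \<alpha> by (intro mult_mono) auto
    then have l: "?n - 1 \<le> ell CARD('n) p" unfolding ell by simp
    have "\<omega> = (\<lambda>x. 0)" if "\<omega> \<in> nonneg_solutions k p" for \<omega>
    proof -
      from that have \<omega>: "\<omega> \<in> solutions k p" and "\<And>x. x \<in> closed_hemisphere k \<Longrightarrow> 0 \<le> \<omega> x"
        by (auto simp: nonneg_solutions_def)
      then show ?thesis
        using nonneg_solution_zero_of_ell_large[OF \<omega> assms(2,1) l]
        by (intro solutions_eqI[OF \<omega> zero_in_solutions]) blast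
    qed
    moreover have "(\<lambda>x. 0) \<in> nonneg_solutions k p"
      using zero_in_solutions by (simp add: nonneg_solutions_def)
    ultimately show ?thesis by blast
  qed
  assume p: "?n / (?n - 1) < p \<and> ereal p < upper_exponent CARD('n)"
  have "?\<alpha> < ?n - 1" using p n assms(2) by (simp add: field_simps)
  \<comment> \<open>For \<open>N = 2\<close> the left side is 0; otherwise this is the bound by the
    upper exponent, rewritten.\<close>
  moreover have "?n - 2 < ?\<alpha>"
  proof (cases "CARD('n) = 2")
    case False
    then have "p < (?n - 1) / (?n - 2)" "2 < ?n" using p assms(1) by (auto simp: upper_exponent_def)
    then show ?thesis using assms(2) by (simp add: field_simps)
  qed (use \<alpha> in simp)
  ultimately obtain \<omega>s where pos: "positive_solution k p \<omega>s"
    and sol: "solutions k p = {\<omega>s, \<lambda>x. - \<omega>s x, \<lambda>x. 0}"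
    using supercritical_classification[OF assms] by blast
  \<comment> \<open>Positivity at the pole rules out the negative and the zero solution.\<close>
  have "\<omega> = \<omega>s" if "positive_solution k p \<omega>" for \<omega>
  proof -
    have "axis k 1 \<in> closed_hemisphere k"
      using axis_in_hemisphere[of k] by (simp add: closed_hemisphere_def)
    then have "0 < \<omega> (axis k 1)" "0 < \<omega>s (axis k 1)" using that pos by (auto simp: positive_solution_def)
    moreover have "\<omega> \<in> {\<omega>s, \<lambda>x. - \<omega>s x, \<lambda>x. 0}"
      using that sol by (simp add: positive_solution_def)
    ultimately show ?thesis by auto
  qed
  then show "\<exists>\<omega>s. positive_solution k p \<omega>s \<and> (\<forall>\<omega>. positive_solution k p \<omega> \<longrightarrow> \<omega> = \<omega>s) \<and>
      solutions k p = {\<omega>s, \<lambda>x. - \<omega>s x, \<lambda>x. 0}"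
    using pos sol by blast
qed

end
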